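(* Fix $p\in(0,1)$ and an integer $k\ge 3$. There exist a constant $c=c(k,p)>0$ and an integer $N=N(k,p)$ such that for every integer $n\ge N$ with $\gcd(n,(k-1)!)=1$ there is an integer $x$ with \[\left|\mathbb{P}[\mathbf{kAP}(S)=x]-\frac{1}{\sigma_n\sqrt{2\pi}}\exp\left(\frac{-(x-\mu_n)^2}{2\sigma_n^2}\right)\right|\ge\frac{c}{\sigma_n},\] where $S\subseteq\mathbb{Z}/n\mathbb{Z}$ is the random set obtained by including each element of $\mathbb{Z}/n\mathbb{Z}$ independently with probability $p$, and $\mu_n$ and $\sigma_n$ are the expectation and standard deviation of $\mathbf{kAP}(S)$.
   Context: For $S\subseteq\mathbb{Z}/n\mathbb{Z}$, $\mathbf{kAP}(S)$ is the number of $k$-term arithmetic progressions contained in $S$: with $x_i=1$ if $i\in S$ and $x_i=0$ otherwise, \[\mathbf{kAP}(S)=\sum_{a\in\mathbb{Z}/n\mathbb{Z}}\ \sum_{d=1}^{\lfloor n/2\rfloor}\ \prod_{i=0}^{k-1}x_{a+id},\] with indices taken modulo $n$. *)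

theory Defs
  imports "HOL-Probability.Probability"
begin

text \<open>
  The ring of integers modulo \<open>n\<close> is represented by its canonical residues \<open>{0..<n}\<close>, and index
  arithmetic is done modulo \<open>n\<close>.  Every pair \<open>(a, d)\<close> with \<open>1 \<le> d \<le> \<lfloor>n / 2\<rfloor>\<close> is counted,
  hence \<open>n div 2\<close> below is integer division.
\<close>

definition kAP :: "nat \<Rightarrow> nat \<Rightarrow> nat set \<Rightarrow> nat" where
  "kAP k n S = (\<Sum>a = 0..<n. \<Sum>d = 1..n div 2. \<Prod>i = 0..<k. indicator S ((a + i * d) mod n))"

text \<open>
  \<open>Pi_pmf\<close> draws the membership bits of the residues \<open>0, \<dots>, n - 1\<close> independently; its default
  value \<open>False\<close> outside \<open>{0..<n}\<close> makes the set below a subset of \<open>{0..<n}\<close>.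
\<close>

definition random_subset_pmf :: "nat \<Rightarrow> real \<Rightarrow> nat set pmf" where
  "random_subset_pmf n p = map_pmf Collect (Pi_pmf {0..<n} False (\<lambda>_. bernoulli_pmf p))"

definition kAP_mean :: "nat \<Rightarrow> real \<Rightarrow> nat \<Rightarrow> real" where
  "kAP_mean k p n = measure_pmf.expectation (random_subset_pmf n p) (\<lambda>S. real (kAP k n S))"

definition kAP_sd :: "nat \<Rightarrow> real \<Rightarrow> nat \<Rightarrow> real" where
  "kAP_sd k p n = sqrt (measure_pmf.variance (random_subset_pmf n p) (\<lambda>S. real (kAP k n S)))"

end

theory Submission
  imports Defs
begin

text \<open>
  Write \<open>y\<^sub>i\<close> for the centred indicator of \<open>i \<in> S\<close> and \<open>M\<close> for the sum of the \<open>y\<^sub>i\<close>. Since \<open>n\<close> is coprime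
  to \<open>(k - 1)!\<close>, every residue lies in the same number of progressions and so does every pair of residues.
  Expanding the products, the linear and quadratic parts of kAP are therefore functions of \<open>M\<close> alone,
  that is, kAP is \<open>\<mu> + A M + B M\<^sup>2 - B n v + Y\<close> with \<open>v = p (1 - p)\<close>, \<open>A\<close> of order \<open>n\<close>, \<open>B\<close> constant, and
  \<open>Y\<close> of degree at least 3 in the \<open>y\<^sub>i\<close> and of standard deviation of order \<open>n\<close>. As \<open>M\<close> takes values in a translate of
  the integers, kAP is concentrated near a set with gaps of order \<open>n\<close>, far below the standard
  deviation, which is of order \<open>n\<^sup>3\<^sup>/\<^sup>2\<close>.

  To detect this, test kAP against a function of modulus one with frequency \<open>\<tau> = 2\<pi> / A\<close> and a quadratic phase that
  cancels \<open>B M\<^sup>2\<close>. Its expectation is, up to a constant phase and a small error, the characteristic function of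
  \<open>Y\<close> at \<open>\<tau>\<close>. Integration by parts shows that the characteristic function of \<open>Y / n\<close> nearly satisfies the
  differential equation of a Gaussian one, so it is bounded below on bounded intervals. If kAP satisfied a
  local limit theorem with a small constant, the expectation would instead be close to an oscillating
  Gaussian sum, which tends to zero by summation by parts.
\<close>

section \<open>Functions of independent Bernoulli variables\<close>

text \<open>The discrete derivative in coordinate \<open>i\<close>. Both values fix the state of
  \<open>i\<close>, so the result ignores whether \<open>i\<close> lies in \<open>S\<close>.\<close>

definition dif :: "nat \<Rightarrow> (nat set \<Rightarrow> 'a::ab_group_add) \<Rightarrow> nat set \<Rightarrow> 'a" where
  "dif i F S = F (insert i S) - F (S - {i})"

lemma sum_Pow_insert:
  fixes f :: "nat set \<Rightarrow> 'a::comm_monoid_add"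
  assumes "finite A" "i \<notin> A"
  shows "(\<Sum>S\<in>Pow (insert i A). f S) = (\<Sum>S\<in>Pow A. f S + f (insert i S))"
proof -
  have "(\<Sum>S\<in>Pow (insert i A). f S) = (\<Sum>S\<in>Pow A. f S) + (\<Sum>S\<in>insert i ` Pow A. f S)"
    unfolding Pow_insert by (rule sum.union_disjoint) (use assms in auto)
  also have "(\<Sum>S\<in>insert i ` Pow A. f S) = (\<Sum>S\<in>Pow A. f (insert i S))"
    by (rule sum.reindex_cong[of "insert i"]) (use assms in \<open>auto simp: inj_on_def\<close>)
  finally show ?thesis
    by (simp add: sum.distrib)
qed

locale bernoulli_subset =
  fixes n :: nat and p :: real
  assumes p_pos: "0 < p" and p_less_1: "p < 1"
begin

definition wt :: "nat set \<Rightarrow> nat set \<Rightarrow> real" where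
  "wt A S = (\<Prod>i\<in>A. if i \<in> S then p else 1 - p)"

text \<open>A finite weighted sum with values in any normed space, so that one notion serves real
  statistics and complex exponentials; \<open>expectation_eq_ev\<close> links it to the pmf.\<close>

definition ev :: "(nat set \<Rightarrow> 'a::real_normed_vector) \<Rightarrow> 'a" where
  "ev F = (\<Sum>S\<in>Pow {..<n}. wt {..<n} S *\<^sub>R F S)"

definition y :: "nat \<Rightarrow> nat set \<Rightarrow> real" where
  "y i S = of_bool (i \<in> S) - p"

text \<open>Products of centred indicators form the orthogonal basis of functions of independent
  biased bits, see \<open>ev_mon_orthogonal\<close>.\<close>

definition mon :: "nat set \<Rightarrow> nat set \<Rightarrow> real" where
  "mon U S = (\<Prod>i\<in>U. y i S)"

definition v :: real where
  "v = p * (1 - p)"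

lemma v_pos: "0 < v" and v_le_1: "v \<le> 1"
  using p_pos p_less_1 by (auto simp: v_def mult_le_one)

lemma wt_nonneg: "0 \<le> wt A S"
  unfolding wt_def using p_pos p_less_1 by (intro prod_nonneg) auto

lemma ev_add: "ev (\<lambda>S. F S + G S) = ev F + ev G"
  by (simp add: ev_def sum.distrib scaleR_add_right)

lemma ev_diff: "ev (\<lambda>S. F S - G S) = ev F - ev G"
  by (simp add: ev_def sum_subtractf scaleR_diff_right)

lemma ev_sum: "ev (\<lambda>S. \<Sum>a\<in>A. F a S) = (\<Sum>a\<in>A. ev (F a))"
  unfolding ev_def scaleR_sum_right by (rule sum.swap)

lemma ev_linear: "bounded_linear h \<Longrightarrow> ev (\<lambda>S. h (F S)) = h (ev F)"
  unfolding ev_def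
  by (simp add: bounded_linear.linear linear_sum linear_scale)

lemma ev_mult_left: "ev (\<lambda>S. c * F S) = c * ev F"
  for c :: "'a::real_normed_algebra"
  by (rule ev_linear) (rule bounded_linear_mult_right)

lemma ev_scaleR: "ev (\<lambda>S. c *\<^sub>R F S) = c *\<^sub>R ev F"
  by (rule ev_linear) (rule bounded_linear_scaleR_right)

lemma ev_cong: "(\<And>S. S \<subseteq> {..<n} \<Longrightarrow> F S = G S) \<Longrightarrow> ev F = ev G"
  by (simp add: ev_def)

lemma ev_mono: "(\<And>S. S \<subseteq> {..<n} \<Longrightarrow> F S \<le> G S) \<Longrightarrow> ev F \<le> ev G"
  for F :: "nat set \<Rightarrow> real"
  unfolding ev_def by (intro sum_mono) (simp add: mult_left_mono wt_nonneg)

lemma norm_ev_le: "norm (ev F) \<le> ev (\<lambda>S. norm (F S))"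
  unfolding ev_def by (rule order_trans[OF norm_sum]) (simp add: wt_nonneg)

text \<open>The subsets of \<open>{..<n}\<close> come in pairs that differ only in \<open>i\<close>.
  Writing \<open>S - {i}\<close> where \<open>S\<close> would do gives the shape of
  \<open>avg\<close>.\<close>

lemma ev_split:
  assumes "i < n"
  shows "ev F = (\<Sum>S\<in>Pow ({..<n} - {i}). wt ({..<n} - {i}) S *\<^sub>R
    (p *\<^sub>R F (insert i S) + (1 - p) *\<^sub>R F (S - {i})))"
proof -
  let ?A = "{..<n} - {i}"
  have A: "{..<n} = insert i ?A"
    using assms by auto
  have wt_insert: "wt (insert i ?A) S = (1 - p) * wt ?A S"
    "wt (insert i ?A) (insert i S) = p * wt ?A S" if "S \<subseteq> ?A" for S
  proof -
    have "wt ?A (insert i S) = wt ?A S"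
      unfolding wt_def by (rule prod.cong) auto
    moreover have "i \<notin> S"
      using that by auto
    moreover have "wt (insert i ?A) S = (if i \<in> S then p else 1 - p) * wt ?A S" for S
      unfolding wt_def by (rule prod.insert) auto
    ultimately show "wt (insert i ?A) S = (1 - p) * wt ?A S"
      "wt (insert i ?A) (insert i S) = p * wt ?A S"
      by auto
  qed
  have "ev F = (\<Sum>S\<in>Pow ?A. wt (insert i ?A) S *\<^sub>R F S + wt (insert i ?A) (insert i S) *\<^sub>R F (insert i S))"
    unfolding ev_def by (subst A, subst (2) A, rule sum_Pow_insert) auto
  also have "\<dots> = (\<Sum>S\<in>Pow ?A. wt ?A S *\<^sub>R (p *\<^sub>R F (insert i S) + (1 - p) *\<^sub>R F (S - {i})))"
  proof (rule sum.cong)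
    fix S assume "S \<in> Pow ?A"
    then have "S \<subseteq> ?A" "S - {i} = S"
      by auto
    then show "wt (insert i ?A) S *\<^sub>R F S + wt (insert i ?A) (insert i S) *\<^sub>R F (insert i S)
      = wt ?A S *\<^sub>R (p *\<^sub>R F (insert i S) + (1 - p) *\<^sub>R F (S - {i}))"
      by (simp add: wt_insert scaleR_add_right mult.commute del: insert_Diff_single)
  qed auto
  finally show ?thesis .
qed

text \<open>Conditional expectation given all coordinates other than \<open>i\<close>.\<close>

definition avg :: "nat \<Rightarrow> (nat set \<Rightarrow> 'a::real_normed_vector) \<Rightarrow> nat set \<Rightarrow> 'a" where
  "avg i F S = p *\<^sub>R F (insert i S) + (1 - p) *\<^sub>R F (S - {i})"

lemma ev_avg:
  assumes "i < n"
  shows "ev (avg i F) = ev F"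
proof -
  have "p *\<^sub>R x + (1 - p) *\<^sub>R x = x" for x :: 'a
    by (simp flip: scaleR_add_left)
  then show ?thesis
    unfolding ev_split[OF assms] avg_def by (auto intro!: sum.cong)
qed

lemma ev_const [simp]: "ev (\<lambda>_. c) = c"
proof -
  have "(\<Sum>S\<in>Pow A. wt A S) = 1" if "finite A" for A
    using that
  proof induction
    case (insert i A)
    have "wt A (insert i S) = wt A S" for S
      unfolding wt_def by (rule prod.cong) (use insert in auto)
    moreover have "wt (insert i A) S = (if i \<in> S then p else 1 - p) * wt A S" for S
      unfolding wt_def by (rule prod.insert) (use insert in auto)
    ultimately have "wt (insert i A) S + wt (insert i A) (insert i S) = wt A S" if "S \<subseteq> A" for S
      using that insert by (auto simp: algebra_simps)
    then have "(\<Sum>S\<in>Pow (insert i A). wt (insert i A) S) = (\<Sum>S\<in>Pow A. wt A S)"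
      using insert by (subst sum_Pow_insert) (auto intro!: sum.cong)
    then show ?case
      using insert by simp
  qed (simp add: wt_def)
  then show ?thesis
    by (simp add: ev_def flip: scaleR_sum_left)
qed

lemma ev_nonneg: "(\<And>S. S \<subseteq> {..<n} \<Longrightarrow> 0 \<le> F S) \<Longrightarrow> 0 \<le> ev F"
  for F :: "nat set \<Rightarrow> real"
  using ev_mono[of "\<lambda>_. 0" F] by simp

lemma norm_ev_bound: "(\<And>S. S \<subseteq> {..<n} \<Longrightarrow> norm (F S) \<le> G S) \<Longrightarrow> norm (ev F) \<le> ev G"
  using ev_mono[of "\<lambda>S. norm (F S)" G] norm_ev_le[of F] by simp

lemma norm_ev_bound_const: "(\<And>S. S \<subseteq> {..<n} \<Longrightarrow> norm (F S) \<le> c) \<Longrightarrow> norm (ev F) \<le> c"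
  using norm_ev_bound[of F "\<lambda>_. c"] by simp

text \<open>Average over coordinate \<open>i\<close> alone: \<open>y i\<close> is
  \<open>1 - p\<close> with probability \<open>p\<close> and \<open>- p\<close> with probability
  \<open>1 - p\<close>, so the two values of \<open>F\<close> get weight \<open>v\<close> with
  opposite signs. This is the integration by parts used throughout.\<close>

lemma stein:
  assumes "i < n"
  shows "ev (\<lambda>S. y i S *\<^sub>R F S) = v *\<^sub>R ev (dif i F)"
proof -
  have "avg i (\<lambda>S. y i S *\<^sub>R F S) = avg i (\<lambda>S. v *\<^sub>R dif i F S)"
  proof
    fix S
    have "p *\<^sub>R x + (1 - p) *\<^sub>R x = x" for x :: 'a
      by (simp flip: scaleR_add_left)
    moreover have "avg i (\<lambda>S. y i S *\<^sub>R F S) S = v *\<^sub>R dif i F S"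
      by (simp add: avg_def y_def dif_def v_def algebra_simps)
    moreover have "avg i (\<lambda>S. v *\<^sub>R dif i F S) S
        = p *\<^sub>R (v *\<^sub>R dif i F S) + (1 - p) *\<^sub>R (v *\<^sub>R dif i F S)"
      unfolding avg_def dif_def by simp
    ultimately show "avg i (\<lambda>S. y i S *\<^sub>R F S) S = avg i (\<lambda>S. v *\<^sub>R dif i F S) S"
      by metis
  qed
  then have "ev (\<lambda>S. y i S *\<^sub>R F S) = ev (\<lambda>S. v *\<^sub>R dif i F S)"
    using ev_avg[OF assms] by metis
  then show ?thesis
    by (simp add: ev_scaleR)
qed

section \<open>Orthogonality of the monomials\<close>

lemma y_insert_diff [simp]:
  "i \<noteq> j \<Longrightarrow> y j (insert i S) = y j S" "i \<noteq> j \<Longrightarrow> y j (S - {i}) = y j S"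
  by (auto simp: y_def)

lemma mon_insert_diff [simp]:
  assumes "i \<notin> U"
  shows "mon U (insert i S) = mon U S" "mon U (S - {i}) = mon U S"
  unfolding mon_def atomize_conj using assms by (intro conjI prod.cong; metis y_insert_diff)

lemma mon_remove: "finite U \<Longrightarrow> i \<in> U \<Longrightarrow> mon U S = y i S * mon (U - {i}) S"
  unfolding mon_def by (rule prod.remove)

lemma dif_mon:
  assumes "finite U"
  shows "dif i (mon U) S = (if i \<in> U then mon (U - {i}) S else 0)"
proof (cases "i \<in> U")
  case True
  have "mon (U - {i}) (insert i S) = mon (U - {i}) S" "mon (U - {i}) (S - {i}) = mon (U - {i}) S"
    by (rule mon_insert_diff; simp)+
  then show ?thesis
    unfolding dif_def mon_remove[OF assms True] using True by (simp add: y_def algebra_simps)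
qed (simp add: dif_def)

lemma abs_y_le_1: "\<bar>y i S\<bar> \<le> 1"
  using p_pos p_less_1 by (auto simp: y_def)

lemma abs_mon_le_1: "\<bar>mon U S\<bar> \<le> 1"
proof -
  have "(\<Prod>i\<in>U. \<bar>y i S\<bar>) \<le> (\<Prod>i\<in>U. 1)"
    by (rule prod_mono) (simp add: abs_y_le_1)
  then show ?thesis
    by (simp add: mon_def abs_prod)
qed

text \<open>The factor \<open>y i\<close> is integrated by parts. The other factors do not involve
  \<open>i\<close>, so the difference falls on \<open>F\<close> alone.\<close>

lemma ev_mon_mult:
  assumes "i \<in> U" "U \<subseteq> {..<n}"
  shows "ev (\<lambda>S. mon U S *\<^sub>R F S) = v *\<^sub>R ev (\<lambda>S. mon (U - {i}) S *\<^sub>R dif i F S)"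
proof -
  have fin: "finite U" and i: "i < n"
    using assms finite_subset by auto
  have "ev (\<lambda>S. mon U S *\<^sub>R F S) = ev (\<lambda>S. y i S *\<^sub>R (mon (U - {i}) S *\<^sub>R F S))"
    by (rule ev_cong) (simp add: mon_remove[OF fin assms(1)])
  also have "\<dots> = v *\<^sub>R ev (dif i (\<lambda>S. mon (U - {i}) S *\<^sub>R F S))"
    by (rule stein[OF i])
  also have "dif i (\<lambda>S. mon (U - {i}) S *\<^sub>R F S) = (\<lambda>S. mon (U - {i}) S *\<^sub>R dif i F S)"
    by (auto simp: dif_def scaleR_diff_right)
  finally show ?thesis .
qed

text \<open>Integrate by parts in a variable that occurs in exactly one of the two monomials: the
  other one has zero difference there.\<close>

lemma ev_mon_orthogonal:
  assumes "U \<subseteq> {..<n}" "V \<subseteq> {..<n}" "U \<noteq> V"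
  shows "ev (\<lambda>S. mon U S * mon V S) = 0"
proof -
  have *: "ev (\<lambda>S. mon U S * mon V S) = 0" if "U \<subseteq> {..<n}" "V \<subseteq> {..<n}" "i \<in> U" "i \<notin> V" for U V i
  proof -
    have "finite V"
      using that finite_subset by auto
    then have "ev (\<lambda>S. mon (U - {i}) S *\<^sub>R dif i (mon V) S) = 0"
      using that by (simp add: dif_mon)
    then show ?thesis
      using ev_mon_mult[of i U "mon V"] that by simp
  qed
  obtain i where "i \<in> U \<and> i \<notin> V \<or> i \<in> V \<and> i \<notin> U"
    using assms by auto
  then show ?thesis
    using *[of U V i] *[of V U i] assms by (auto simp: mult.commute)
qed

lemma ev_mon_eq_0:
  assumes "U \<subseteq> {..<n}" "U \<noteq> {}"
  shows "ev (mon U) = 0"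
  using ev_mon_orthogonal[of U "{}"] assms by (simp add: mon_def[of "{}"])

text \<open>Only index pairs with equal supports survive in the expanded square, and each index has
  at most \<open>L\<close> such partners.\<close>

lemma ev_sum_mon_sq_le:
  assumes "finite I" and "\<And>e. e \<in> I \<Longrightarrow> A e \<subseteq> {..<n}" and "\<And>e. e \<in> I \<Longrightarrow> \<bar>c e\<bar> \<le> 1"
    and mult: "\<And>e. e \<in> I \<Longrightarrow> real (card {f \<in> I. A f = A e}) \<le> L"
  shows "ev (\<lambda>S. (\<Sum>e\<in>I. c e * mon (A e) S)\<^sup>2) \<le> L * card I"
proof -
  have "ev (\<lambda>S. (\<Sum>e\<in>I. c e * mon (A e) S)\<^sup>2)
      = ev (\<lambda>S. \<Sum>e\<in>I. \<Sum>f\<in>I. (c e * c f) * (mon (A e) S * mon (A f) S))"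
    by (simp add: power2_eq_square sum_product algebra_simps)
  also have "\<dots> = (\<Sum>e\<in>I. \<Sum>f\<in>I. (c e * c f) * ev (\<lambda>S. mon (A e) S * mon (A f) S))"
    by (simp only: ev_sum ev_mult_left)
  also have "\<dots> \<le> (\<Sum>e\<in>I. \<Sum>f\<in>I. of_bool (A f = A e))"
  proof (intro sum_mono)
    fix e f assume ef: "e \<in> I" "f \<in> I"
    show "(c e * c f) * ev (\<lambda>S. mon (A e) S * mon (A f) S) \<le> of_bool (A f = A e)"
    proof (cases "A f = A e")
      case True
      have "norm (ev (\<lambda>S. mon (A e) S * mon (A f) S)) \<le> 1"
        by (rule norm_ev_bound_const) (simp add: abs_mult mult_le_one abs_mon_le_1)
      then have "\<bar>(c e * c f) * ev (\<lambda>S. mon (A e) S * mon (A f) S)\<bar> \<le> 1"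
        using ef assms(3)[of e] assms(3)[of f] unfolding abs_mult
        by (intro mult_le_one) auto
      then show ?thesis
        using True by simp
    qed (use ef assms(2) ev_mon_orthogonal[of "A e" "A f"] in auto)
  qed
  also have "\<dots> = (\<Sum>e\<in>I. real (card {f \<in> I. A f = A e}))"
    using assms(1) by (simp add: Int_def)
  also have "\<dots> \<le> (\<Sum>e\<in>I. L)"
    by (rule sum_mono) (rule mult)
  finally show ?thesis
    by (simp add: mult.commute)
qed

section \<open>Poincare inequality by averaging out coordinates\<close>

lemma avg_sq_le: "(avg i F S)\<^sup>2 \<le> avg i (\<lambda>S. (F S)\<^sup>2) S"
  and avg_sq: "avg i (\<lambda>S. (F S)\<^sup>2) S = (avg i F S)\<^sup>2 + v * (dif i F S)\<^sup>2"
  for F :: "nat set \<Rightarrow> real"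
proof -
  show eq: "avg i (\<lambda>S. (F S)\<^sup>2) S = (avg i F S)\<^sup>2 + v * (dif i F S)\<^sup>2"
    by (simp add: avg_def dif_def v_def power2_eq_square algebra_simps)
  show "(avg i F S)\<^sup>2 \<le> avg i (\<lambda>S. (F S)\<^sup>2) S"
    unfolding eq using v_pos by simp
qed

fun avgs :: "nat \<Rightarrow> (nat set \<Rightarrow> real) \<Rightarrow> nat set \<Rightarrow> real" where
  "avgs 0 F = F"
| "avgs (Suc m) F = avg m (avgs m F)"

lemma dif_avg:
  assumes "i \<noteq> j"
  shows "dif j (avg i F) = avg i (dif j F)"
proof
  fix S
  have "S - {j} - {i} = S - {i} - {j}" "insert i (S - {j}) = insert i S - {j}"
    "insert j S - {i} = insert j (S - {i})" "insert j (insert i S) = insert i (insert j S)"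
    using assms by auto
  then show "dif j (avg i F) S = avg i (dif j F) S"
    by (simp add: dif_def avg_def algebra_simps)
qed

text \<open>Averaging over a coordinate other than \<open>j\<close> commutes with
  \<open>dif j\<close> and, by Jensen, does not increase the second moment.\<close>

lemma ev_dif_avgs_sq_le:
  "m \<le> j \<Longrightarrow> j < n \<Longrightarrow> ev (\<lambda>S. (dif j (avgs m F) S)\<^sup>2) \<le> ev (\<lambda>S. (dif j F S)\<^sup>2)"
proof (induction m)
  case (Suc m)
  have "ev (\<lambda>S. (dif j (avgs (Suc m) F) S)\<^sup>2) = ev (\<lambda>S. (avg m (dif j (avgs m F)) S)\<^sup>2)"
    using Suc by (simp add: dif_avg)
  also have "\<dots> \<le> ev (avg m (\<lambda>S. (dif j (avgs m F) S)\<^sup>2))"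
    by (rule ev_mono) (rule avg_sq_le)
  also have "\<dots> = ev (\<lambda>S. (dif j (avgs m F) S)\<^sup>2)"
    using Suc by (intro ev_avg) auto
  finally show ?case
    using Suc by simp
qed simp

text \<open>For \<open>m = n\<close> this makes \<open>avgs\<close> constant on the subsets of
  \<open>{..<n}\<close>, so that its second moment is its squared mean.\<close>

lemma avgs_cong:
  "(\<And>x. m \<le> x \<Longrightarrow> x \<in> S \<longleftrightarrow> x \<in> S') \<Longrightarrow> avgs m F S = avgs m F S'"
proof (induction m arbitrary: S S')
  case 0
  then have "S = S'" by auto
  then show ?case by simp
next
  case (Suc m)
  have mem: "x \<in> S \<longleftrightarrow> x \<in> S'" if "m \<le> x" "x \<noteq> m" for x
    using Suc.prems that by simp
  have "avgs m F (insert m S) = avgs m F (insert m S')" "avgs m F (S - {m}) = avgs m F (S' - {m})"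
    by (rule Suc.IH; use mem in blast)+
  then show ?case
    by (simp add: avg_def)
qed

text \<open>The coordinates are averaged out one at a time; each step loses the variance in that coordinate.\<close>

lemma poincare:
  fixes F :: "nat set \<Rightarrow> real"
  shows "ev (\<lambda>S. (F S)\<^sup>2) \<le> (ev F)\<^sup>2 + (\<Sum>j<n. ev (\<lambda>S. (dif j F S)\<^sup>2))"
proof -
  have *: "ev (avgs m F) = ev F \<and>
    ev (\<lambda>S. (F S)\<^sup>2) \<le> ev (\<lambda>S. (avgs m F S)\<^sup>2) + (\<Sum>j<m. ev (\<lambda>S. (dif j F S)\<^sup>2))" if "m \<le> n" for m
    using that
  proof (induction m)
    case (Suc m)
    have m: "m < n"
      using Suc by simp
    have "avg m (\<lambda>S. (avgs m F S)\<^sup>2)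
        = (\<lambda>S. (avgs (Suc m) F S)\<^sup>2 + v * (dif m (avgs m F) S)\<^sup>2)"
      by (rule ext) (simp add: avg_sq)
    then have "ev (\<lambda>S. (avgs m F S)\<^sup>2)
        = ev (\<lambda>S. (avgs (Suc m) F S)\<^sup>2 + v * (dif m (avgs m F) S)\<^sup>2)"
      using ev_avg[OF m, of "\<lambda>S. (avgs m F S)\<^sup>2"] by metis
    also have "\<dots> = ev (\<lambda>S. (avgs (Suc m) F S)\<^sup>2) + v * ev (\<lambda>S. (dif m (avgs m F) S)\<^sup>2)"
      by (simp only: ev_add ev_mult_left)
    also have "v * ev (\<lambda>S. (dif m (avgs m F) S)\<^sup>2) \<le> 1 * ev (\<lambda>S. (dif m (avgs m F) S)\<^sup>2)"
      using v_le_1 by (intro mult_right_mono ev_nonneg) auto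
    also have "\<dots> \<le> ev (\<lambda>S. (dif m F S)\<^sup>2)"
      using ev_dif_avgs_sq_le[of m m F] m by simp
    finally show ?case
      using Suc m by (simp add: ev_avg)
  qed simp
  have const: "avgs n F S = avgs n F {}" if "S \<subseteq> {..<n}" for S
    by (rule avgs_cong) (use that in force)
  have "ev (avgs n F) = ev (\<lambda>_. avgs n F {})"
    by (rule ev_cong) (rule const)
  moreover have "ev (\<lambda>S. (avgs n F S)\<^sup>2) = ev (\<lambda>_. (avgs n F {})\<^sup>2)"
    by (rule ev_cong) (rule arg_cong[OF const])
  ultimately show ?thesis
    using *[of n] by simp
qed

end

section \<open>Polynomials supported on sets with bounded pair degree\<close>

lemma card_UN_le_mult:
  assumes "finite A" and "\<And>a. a \<in> A \<Longrightarrow> card (B a) \<le> b"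
  shows "card (\<Union>a\<in>A. B a) \<le> card A * b"
proof -
  have "card (\<Union>a\<in>A. B a) \<le> (\<Sum>a\<in>A. card (B a))"
    by (rule card_UN_le) fact
  also have "\<dots> \<le> card A * b"
    using sum_bounded_above[of A "\<lambda>a. card (B a)" b] assms(2) by simp
  finally show ?thesis .
qed

lemma dif_sum: "dif j (\<lambda>S. \<Sum>a\<in>A. F a S) S = (\<Sum>a\<in>A. dif j (F a) S)"
  by (simp add: dif_def sum_subtractf)

lemma dif_mult_left: "dif j (\<lambda>S. c * F S) S = c * dif j F S"
  for F :: "nat set \<Rightarrow> real"
  by (simp add: dif_def algebra_simps)

lemma dif_eq_cases: "F S = F (insert j S) \<or> F S = F (S - {j})"
  by (cases "j \<in> S") (auto simp: insert_absorb)

text \<open>Factor the difference of squares. One of the two values is \<open>F S\<close> and the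
  other is within \<open>l\<close> of it, so their sum is at most
  \<open>2 * \<bar>F S\<bar> + l\<close>.\<close>

lemma abs_dif_sq_le:
  fixes F :: "nat set \<Rightarrow> real"
  assumes "\<bar>dif j F S\<bar> \<le> l"
  shows "(dif j (\<lambda>S. (F S)\<^sup>2) S)\<^sup>2 \<le> l\<^sup>2 * (8 * (F S)\<^sup>2 + 2 * l\<^sup>2)"
proof -
  let ?a = "F (insert j S)" and ?b = "F (S - {j})"
  have "\<bar>?a + ?b\<bar> \<le> 2 * \<bar>F S\<bar> + l"
    using dif_eq_cases[of F S j] assms unfolding dif_def by linarith
  then have "(?a + ?b)\<^sup>2 \<le> (2 * \<bar>F S\<bar> + l)\<^sup>2"
    by (metis abs_ge_zero power2_abs power_mono)
  also have "\<dots> \<le> 8 * (F S)\<^sup>2 + 2 * l\<^sup>2"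
    using sum_squares_bound[of "2 * \<bar>F S\<bar>" l] by (simp add: power2_sum power_mult_distrib)
  finally have "(?a + ?b)\<^sup>2 \<le> 8 * (F S)\<^sup>2 + 2 * l\<^sup>2" .
  moreover have "(?a - ?b)\<^sup>2 \<le> l\<^sup>2"
    using assms unfolding dif_def by (metis abs_ge_zero power2_abs power_mono)
  moreover have "dif j (\<lambda>S. (F S)\<^sup>2) S = (?a - ?b) * (?a + ?b)"
    by (simp add: dif_def power2_eq_square algebra_simps)
  ultimately show ?thesis
    by (simp add: power_mult_distrib mult_mono)
qed

text \<open>Abstracts the part of kAP of degree at least 3: a weighted hypergraph in which two
  distinct points lie in at most \<open>L\<close> edges. Edges are indices, since different ones may
  carry the same vertex set.\<close>

locale edge_family = bernoulli_subset n p for n :: nat and p :: real +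
  fixes I :: "'e set" and U :: "'e \<Rightarrow> nat set" and c :: "'e \<Rightarrow> real" and k L :: nat
  assumes finite_I: "finite I"
    and U_subset: "e \<in> I \<Longrightarrow> U e \<subseteq> {..<n}"
    and card_U_ge: "e \<in> I \<Longrightarrow> 3 \<le> card (U e)"
    and card_U_le: "e \<in> I \<Longrightarrow> card (U e) \<le> k"
    and abs_c_le_1: "e \<in> I \<Longrightarrow> \<bar>c e\<bar> \<le> 1"
    and pair_degree: "i \<noteq> j \<Longrightarrow> card {e \<in> I. i \<in> U e \<and> j \<in> U e} \<le> L"
    and L_pos: "1 \<le> L"
begin

definition Y :: "nat set \<Rightarrow> real" where
  "Y S = (\<Sum>e\<in>I. c e * mon (U e) S)"

definition star :: "nat \<Rightarrow> 'e set" where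
  "star i = {e \<in> I. i \<in> U e}"

text \<open>For \<open>w = c\<close> this is the discrete derivative of \<open>Y\<close>
  (\<open>dif_Y\<close>). The weight is free so that the same bounds cover
  \<open>c'\<close>.\<close>

definition link :: "('e \<Rightarrow> real) \<Rightarrow> nat \<Rightarrow> nat set \<Rightarrow> real" where
  "link w i S = (\<Sum>e\<in>star i. w e * mon (U e - {i}) S)"

definition c' :: "'e \<Rightarrow> real" where
  "c' e = c e / card (U e)"

section \<open>Edge counts and moments of the derivatives\<close>

lemma finite_star: "finite (star i)"
  unfolding star_def using finite_I by simp

lemma finite_U: "e \<in> I \<Longrightarrow> finite (U e)"
  using U_subset finite_subset by blast

text \<open>Edge size at least 3 enters here: a pair of points remains after \<open>i\<close> is
  removed, and a pair determines the edge up to \<open>L\<close> choices.\<close>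

lemma two_other:
  assumes "e \<in> I"
  obtains a b where "a \<in> U e - {i}" "b \<in> U e - {i}" "a \<noteq> b"
proof -
  have "2 \<le> card (U e - {i})"
    using card_U_ge[OF assms] card_Diff_singleton_if[of "U e" i] by auto
  then obtain X where "X \<subseteq> U e - {i}" "card X = 2"
    by (meson obtain_subset_with_card_n)
  then show ?thesis
    using that by (auto simp: card_2_iff)
qed

text \<open>An edge through \<open>i\<close> has a second point \<open>j\<close>: at most
  \<open>n\<close> choices for \<open>j\<close>, then \<open>L\<close> for the edge.\<close>

lemma card_star_le: "card (star i) \<le> L * n"
proof -
  have "star i \<subseteq> (\<Union>j\<in>{..<n} - {i}. {e \<in> I. i \<in> U e \<and> j \<in> U e})"
  proof
    fix e assume e: "e \<in> star i"
    then have "e \<in> I" by (simp add: star_def)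
    then obtain a where "a \<in> U e - {i}"
      using two_other by blast
    then show "e \<in> (\<Union>j\<in>{..<n} - {i}. {e \<in> I. i \<in> U e \<and> j \<in> U e})"
      using e U_subset by (auto simp: star_def)
  qed
  then have "card (star i) \<le> card (\<Union>j\<in>{..<n} - {i}. {e \<in> I. i \<in> U e \<and> j \<in> U e})"
    by (rule card_mono[rotated]) (simp add: finite_I)
  also have "\<dots> \<le> card ({..<n} - {i}) * L"
    by (rule card_UN_le_mult) (auto intro: pair_degree)
  also have "\<dots> \<le> n * L"
    using card_Diff1_le[of "{..<n}" i] by simp
  finally show ?thesis
    by (simp add: mult.commute)
qed

lemma card_I_le: "card I \<le> L * n\<^sup>2"
proof -
  have "I \<subseteq> (\<Union>i<n. star i)"
  proof
    fix e assume e: "e \<in> I"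
    obtain a where "a \<in> U e"
      by (rule two_other[OF e]) blast
    then show "e \<in> (\<Union>i<n. star i)"
      using U_subset[OF e] e by (auto simp: star_def)
  qed
  then have "card I \<le> card (\<Union>i<n. star i)"
    by (rule card_mono[rotated]) (simp add: finite_star)
  also have "\<dots> \<le> card {..<n} * (L * n)"
    by (rule card_UN_le_mult) (auto intro: card_star_le)
  finally show ?thesis
    by (simp add: power2_eq_square mult.commute mult.left_commute)
qed

lemma abs_c'_le_1: "e \<in> I \<Longrightarrow> \<bar>c' e\<bar> \<le> 1"
  using abs_c_le_1[of e] card_U_ge[of e] by (simp add: c'_def field_simps)

lemma dif_Y: "dif i Y S = link c i S"
proof -
  have "dif i Y S = (\<Sum>e\<in>I. c e * dif i (mon (U e)) S)"
    unfolding Y_def[abs_def] by (simp add: dif_sum dif_mult_left)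
  also have "\<dots> = (\<Sum>e\<in>I. if i \<in> U e then c e * mon (U e - {i}) S else 0)"
    by (intro sum.cong) (auto simp: dif_mon finite_U)
  also have "\<dots> = link c i S"
    by (simp add: link_def star_def sum.inter_filter finite_I)
  finally show ?thesis .
qed

lemma ev_Y: "ev Y = 0"
proof -
  have "ev (mon (U e)) = 0" if "e \<in> I" for e
    by (rule two_other[OF that]) (use U_subset[OF that] in \<open>auto intro: ev_mon_eq_0\<close>)
  then show ?thesis
    unfolding Y_def[abs_def] by (simp add: ev_sum ev_mult_left)
qed

lemma ev_Y_sq_le: "ev (\<lambda>S. (Y S)\<^sup>2) \<le> L\<^sup>2 * n\<^sup>2"
proof -
  have "ev (\<lambda>S. (Y S)\<^sup>2) \<le> real L * card I"
    unfolding Y_def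
  proof (rule ev_sum_mon_sq_le)
    fix e assume e: "e \<in> I"
    then obtain a b where ab: "a \<in> U e" "b \<in> U e" "a \<noteq> b"
      using two_other by (metis DiffE)
    have "card {f \<in> I. U f = U e} \<le> card {f \<in> I. a \<in> U f \<and> b \<in> U f}"
      by (rule card_mono) (use ab finite_I in auto)
    then show "real (card {f \<in> I. U f = U e}) \<le> real L"
      using pair_degree[OF ab(3)] by linarith
  qed (simp_all add: finite_I U_subset abs_c_le_1)
  also have "\<dots> \<le> real L * real (L * n\<^sup>2)"
    by (intro mult_left_mono of_nat_mono card_I_le) simp
  finally show ?thesis
    by (simp add: power2_eq_square)
qed

text \<open>A monomial of the link still contains some point \<open>a\<close>, and \<open>a\<close>
  together with \<open>i\<close> determines the edge up to \<open>L\<close> choices; this bounds the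
  multiplicity of supports.\<close>

lemma ev_link_sq_le:
  assumes "\<And>e. e \<in> I \<Longrightarrow> \<bar>w e\<bar> \<le> 1"
  shows "ev (\<lambda>S. (link w i S)\<^sup>2) \<le> L\<^sup>2 * n"
proof -
  have "ev (\<lambda>S. (link w i S)\<^sup>2) \<le> real L * card (star i)"
    unfolding link_def
  proof (rule ev_sum_mon_sq_le)
    fix e assume e: "e \<in> star i"
    then have eI: "e \<in> I" by (simp add: star_def)
    then obtain a where a: "a \<in> U e - {i}"
      using two_other by blast
    have "card {f \<in> star i. U f - {i} = U e - {i}} \<le> card {f \<in> I. a \<in> U f \<and> i \<in> U f}"
      by (rule card_mono) (use a finite_I in \<open>auto simp: star_def\<close>)
    also have "\<dots> \<le> L"
      by (rule pair_degree) (use a in auto)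
    finally show "real (card {f \<in> star i. U f - {i} = U e - {i}}) \<le> real L"
      by simp
  qed (use U_subset assms finite_star in \<open>auto simp: star_def\<close>)
  also have "\<dots> \<le> real L * real (L * n)"
    by (intro mult_left_mono of_nat_mono card_star_le) simp
  finally show ?thesis
    by (simp add: power2_eq_square)
qed

text \<open>Only edges containing both \<open>i\<close> and \<open>j\<close> react to a change in
  \<open>j\<close>.\<close>

lemma abs_dif_link_le:
  assumes "\<And>e. e \<in> I \<Longrightarrow> \<bar>w e\<bar> \<le> 1"
  shows "\<bar>dif j (link w i) S\<bar> \<le> L"
proof -
  have "\<bar>dif j (link w i) S\<bar> = \<bar>\<Sum>e\<in>star i. w e * dif j (mon (U e - {i})) S\<bar>"
    unfolding link_def[abs_def] by (simp add: dif_sum dif_mult_left)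
  also have "\<dots> \<le> (\<Sum>e\<in>star i. \<bar>w e * dif j (mon (U e - {i})) S\<bar>)"
    by (rule sum_abs)
  also have "\<dots> \<le> (\<Sum>e\<in>star i. of_bool (j \<in> U e - {i}))"
  proof (rule sum_mono)
    fix e assume "e \<in> star i"
    then have "e \<in> I" by (simp add: star_def)
    then show "\<bar>w e * dif j (mon (U e - {i})) S\<bar> \<le> of_bool (j \<in> U e - {i})"
      using assms[of e] abs_mon_le_1[of "U e - {i} - {j}" S]
      by (auto simp: dif_mon finite_U abs_mult mult_le_one)
  qed
  also have "\<dots> = real (card {e \<in> star i. j \<in> U e - {i}})"
    using finite_star by (simp add: Int_def)
  also have "card {e \<in> star i. j \<in> U e - {i}} \<le> L"
  proof (cases "i = j")
    case False
    then have "{e \<in> star i. j \<in> U e - {i}} = {e \<in> I. i \<in> U e \<and> j \<in> U e}"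
      by (auto simp: star_def)
    then show ?thesis
      using pair_degree[OF False] by simp
  qed simp
  finally show ?thesis
    by simp
qed

text \<open>Apply the Poincare inequality to the square of the link. As the link changes by at most
  \<open>L\<close> per coordinate, its second moment controls the derivatives of the square.\<close>

lemma ev_link_pow4_le:
  assumes "\<And>e. e \<in> I \<Longrightarrow> \<bar>w e\<bar> \<le> 1"
  shows "ev (\<lambda>S. (link w i S) ^ 4) \<le> 11 * L ^ 4 * n\<^sup>2"
proof -
  let ?D = "link w i"
  have sq: "ev (\<lambda>S. (?D S)\<^sup>2) \<le> L\<^sup>2 * n"
    by (rule ev_link_sq_le) fact
  have nonneg: "0 \<le> ev (\<lambda>S. (?D S)\<^sup>2)"
    by (rule ev_nonneg) simp
  have "ev (\<lambda>S. (?D S) ^ 4) = ev (\<lambda>S. ((?D S)\<^sup>2)\<^sup>2)"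
    by simp
  also have "\<dots> \<le> (ev (\<lambda>S. (?D S)\<^sup>2))\<^sup>2 + (\<Sum>j<n. ev (\<lambda>S. (dif j (\<lambda>S. (?D S)\<^sup>2) S)\<^sup>2))"
    by (rule poincare)
  also have "\<dots> \<le> (L\<^sup>2 * n)\<^sup>2 + (\<Sum>j<n. (real L)\<^sup>2 * (8 * (L\<^sup>2 * n) + 2 * (real L)\<^sup>2))"
  proof (intro add_mono sum_mono)
    show "(ev (\<lambda>S. (?D S)\<^sup>2))\<^sup>2 \<le> (L\<^sup>2 * n)\<^sup>2"
      using power_mono[OF sq nonneg, of 2] by simp
    fix j
    have "ev (\<lambda>S. (dif j (\<lambda>S. (?D S)\<^sup>2) S)\<^sup>2) \<le> ev (\<lambda>S. (real L)\<^sup>2 * (8 * (?D S)\<^sup>2 + 2 * (real L)\<^sup>2))"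
      by (intro ev_mono abs_dif_sq_le abs_dif_link_le assms)
    also have "\<dots> = (real L)\<^sup>2 * (8 * ev (\<lambda>S. (?D S)\<^sup>2) + 2 * (real L)\<^sup>2)"
      by (simp add: ev_mult_left ev_add)
    also have "\<dots> \<le> (real L)\<^sup>2 * (8 * (L\<^sup>2 * n) + 2 * (real L)\<^sup>2)"
      using sq by (intro mult_left_mono add_mono) auto
    finally show "ev (\<lambda>S. (dif j (\<lambda>S. (?D S)\<^sup>2) S)\<^sup>2) \<le> (real L)\<^sup>2 * (8 * (L\<^sup>2 * n) + 2 * (real L)\<^sup>2)" .
  qed
  also have "\<dots> = real (L ^ 4) * (9 * real (n\<^sup>2) + 2 * real n)"
    by (simp add: power2_eq_square power4_eq_xxxx algebra_simps)
  also have "\<dots> \<le> real (L ^ 4) * (11 * real (n\<^sup>2))"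
  proof (rule mult_left_mono)
    have "n \<le> n\<^sup>2"
      by (simp add: power2_eq_square)
    then have "real n \<le> real (n\<^sup>2)"
      by (rule of_nat_mono)
    then show "9 * real (n\<^sup>2) + 2 * real n \<le> 11 * real (n\<^sup>2)"
      by linarith
  qed simp
  finally show ?thesis
    by simp
qed

text \<open>Weighting \<open>c e\<close> by \<open>1 / card (U e)\<close> shares the integration by parts of \<open>mon (U e)\<close> equally among
  its variables.\<close>

lemma ev_Y_mult:
  "ev (\<lambda>S. Y S *\<^sub>R G S) = v *\<^sub>R (\<Sum>i<n. ev (\<lambda>S. link c' i S *\<^sub>R dif i G S))"
proof -
  have "ev (\<lambda>S. Y S *\<^sub>R G S) = (\<Sum>e\<in>I. c e *\<^sub>R ev (\<lambda>S. mon (U e) S *\<^sub>R G S))"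
    unfolding Y_def scaleR_sum_left ev_sum by (simp flip: scaleR_scaleR add: ev_scaleR)
  also have "\<dots> = (\<Sum>e\<in>I. \<Sum>i\<in>U e. v *\<^sub>R c' e *\<^sub>R ev (\<lambda>S. mon (U e - {i}) S *\<^sub>R dif i G S))"
  proof (rule sum.cong)
    fix e assume e: "e \<in> I"
    have "(\<Sum>i\<in>U e. v *\<^sub>R c' e *\<^sub>R ev (\<lambda>S. mon (U e - {i}) S *\<^sub>R dif i G S))
        = (\<Sum>i\<in>U e. c' e *\<^sub>R ev (\<lambda>S. mon (U e) S *\<^sub>R G S))"
      using e ev_mon_mult[OF _ U_subset[OF e], of _ G]
      by (intro sum.cong refl) (simp add: mult.commute)
    also have "\<dots> = (card (U e) * c' e) *\<^sub>R ev (\<lambda>S. mon (U e) S *\<^sub>R G S)"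
      by (simp add: sum_constant_scaleR)
    also have "card (U e) * c' e = c e"
      using card_U_ge[OF e] by (simp add: c'_def)
    finally show "c e *\<^sub>R ev (\<lambda>S. mon (U e) S *\<^sub>R G S)
        = (\<Sum>i\<in>U e. v *\<^sub>R c' e *\<^sub>R ev (\<lambda>S. mon (U e - {i}) S *\<^sub>R dif i G S))" ..
  qed simp
  also have "\<dots> = (\<Sum>e\<in>I. \<Sum>i | i \<in> {..<n} \<and> i \<in> U e. v *\<^sub>R c' e *\<^sub>R ev (\<lambda>S. mon (U e - {i}) S *\<^sub>R dif i G S))"
    using U_subset by (intro sum.cong refl) auto
  also have "\<dots> = (\<Sum>i<n. \<Sum>e | e \<in> I \<and> i \<in> U e. v *\<^sub>R c' e *\<^sub>R ev (\<lambda>S. mon (U e - {i}) S *\<^sub>R dif i G S))"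
    by (rule sum.swap_restrict) (use finite_I in auto)
  also have "\<dots> = v *\<^sub>R (\<Sum>i<n. ev (\<lambda>S. link c' i S *\<^sub>R dif i G S))"
    unfolding link_def scaleR_sum_left ev_sum scaleR_sum_right star_def
    by (simp flip: scaleR_scaleR add: ev_scaleR)
  finally show ?thesis .
qed

section \<open>The quadratic form in the links and its fluctuations\<close>

definition J :: "(nat \<times> 'e \<times> 'e) set" where
  "J = (SIGMA i:{..<n}. star i \<times> star i)"

text \<open>The sum of \<open>link c' i * link c i\<close> is split according to whether \<open>U e\<close> and \<open>U f\<close> share a point
  besides \<open>i\<close>. If they do (\<open>T1\<close>), then \<open>e\<close> determines \<open>f\<close> up to boundedly many choices, so \<open>T1\<close> has few
  terms; if not (\<open>T2\<close>), each term is a single monomial, which allows to use orthogonality.\<close>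

definition J1 :: "(nat \<times> 'e \<times> 'e) set" where
  "J1 = {(i, e, f) \<in> J. (U e - {i}) \<inter> (U f - {i}) \<noteq> {}}"

definition triple_term :: "nat \<times> 'e \<times> 'e \<Rightarrow> nat set \<Rightarrow> real" where
  "triple_term = (\<lambda>(i, e, f) S. (c' e * c f) * (mon (U e - {i}) S * mon (U f - {i}) S))"

definition T1 :: "nat set \<Rightarrow> real" where
  "T1 S = (\<Sum>t\<in>J1. triple_term t S)"

definition T2 :: "nat set \<Rightarrow> real" where
  "T2 S = (\<Sum>t\<in>J - J1. triple_term t S)"

lemma finite_J: "finite J" and J1_subset: "J1 \<subseteq> J" and finite_J1: "finite J1"
proof -
  show "finite J" "J1 \<subseteq> J"
    unfolding J_def J1_def by (auto simp: finite_star)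
  then show "finite J1"
    by (rule rev_finite_subset)
qed

lemma sum_link_mult: "(\<Sum>i<n. link c' i S * link c i S) = T1 S + T2 S"
proof -
  have "(\<Sum>i<n. link c' i S * link c i S) = (\<Sum>i<n. \<Sum>(e, f)\<in>star i \<times> star i. triple_term (i, e, f) S)"
    unfolding link_def sum_product triple_term_def
    by (simp add: sum.cartesian_product algebra_simps)
  also have "\<dots> = (\<Sum>t\<in>J. triple_term t S)"
    unfolding J_def by (subst sum.Sigma) (auto simp: finite_star intro!: sum.cong)
  finally show ?thesis
    unfolding T1_def T2_def using sum.subset_diff[OF J1_subset finite_J] by (simp add: add.commute)
qed

text \<open>There are order \<open>n\<close> choices of \<open>e\<close> through \<open>j\<close>.
  Then \<open>i\<close> and a shared point \<open>l\<close> in \<open>U e\<close>, and an edge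
  \<open>f\<close> through \<open>i\<close> and \<open>l\<close>, leave boundedly many choices. The
  second bound exchanges \<open>e\<close> and \<open>f\<close>.\<close>

lemma card_J1_at:
  assumes "j < n"
  shows "card {(i, e, f) \<in> J1. j \<in> U e} \<le> L * n * (k * (k * L))"
    and "card {(i, e, f) \<in> J1. j \<in> U f} \<le> L * n * (k * (k * L))"
proof -
  let ?B = "\<Union>e\<in>star j. \<Union>i\<in>U e. \<Union>l\<in>U e - {i}. (\<lambda>f. (i, e, f)) ` {f \<in> I. i \<in> U f \<and> l \<in> U f}"
  let ?B' = "\<Union>f\<in>star j. \<Union>i\<in>U f. \<Union>l\<in>U f - {i}. (\<lambda>e. (i, e, f)) ` {e \<in> I. i \<in> U e \<and> l \<in> U e}"
  \<comment> \<open>\<open>h\<close> assembles the triple around the free edge, so that one count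
    serves both orders.\<close>
  have inner: "card (\<Union>i\<in>U e. \<Union>l\<in>U e - {i}. h i l ` {f \<in> I. i \<in> U f \<and> l \<in> U f}) \<le> k * (k * L)"
    if "e \<in> I" for e and h :: "nat \<Rightarrow> nat \<Rightarrow> 'e \<Rightarrow> nat \<times> 'e \<times> 'e"
  proof -
    have "card (\<Union>i\<in>U e. \<Union>l\<in>U e - {i}. h i l ` {f \<in> I. i \<in> U f \<and> l \<in> U f}) \<le> card (U e) * (k * L)"
    proof (rule card_UN_le_mult)
      fix i assume i: "i \<in> U e"
      have "card (\<Union>l\<in>U e - {i}. h i l ` {f \<in> I. i \<in> U f \<and> l \<in> U f}) \<le> card (U e - {i}) * L"
      proof (rule card_UN_le_mult)
        fix l assume "l \<in> U e - {i}"
        then have "card {f \<in> I. i \<in> U f \<and> l \<in> U f} \<le> L"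
          by (intro pair_degree) auto
        then show "card (h i l ` {f \<in> I. i \<in> U f \<and> l \<in> U f}) \<le> L"
          using card_image_le[of "{f \<in> I. i \<in> U f \<and> l \<in> U f}" "h i l"] finite_I by simp
      qed (use that finite_U in auto)
      also have "\<dots> \<le> k * L"
        using card_Diff1_le[of "U e" i] card_U_le[OF that] by (intro mult_right_mono) auto
      finally show "card (\<Union>l\<in>U e - {i}. h i l ` {f \<in> I. i \<in> U f \<and> l \<in> U f}) \<le> k * L" .
    qed (use that finite_U in auto)
    also have "\<dots> \<le> k * (k * L)"
      using card_U_le[OF that] by (rule mult_right_mono) simp
    finally show ?thesis .
  qed
  have fin: "finite ?B" "finite ?B'"
    using finite_I finite_star finite_U by (auto simp: star_def)
  have "{(i, e, f) \<in> J1. j \<in> U e} \<subseteq> ?B"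
    unfolding J1_def J_def star_def by auto
  then have "card {(i, e, f) \<in> J1. j \<in> U e} \<le> card ?B"
    by (rule card_mono[OF fin(1)])
  also have "\<dots> \<le> card (star j) * (k * (k * L))"
    by (rule card_UN_le_mult[OF finite_star]) (rule inner, simp add: star_def)
  also have "\<dots> \<le> L * n * (k * (k * L))"
    using card_star_le by (rule mult_right_mono) simp
  finally show "card {(i, e, f) \<in> J1. j \<in> U e} \<le> L * n * (k * (k * L))" .
  have "{(i, e, f) \<in> J1. j \<in> U f} \<subseteq> ?B'"
    unfolding J1_def J_def star_def by auto
  then have "card {(i, e, f) \<in> J1. j \<in> U f} \<le> card ?B'"
    by (rule card_mono[OF fin(2)])
  also have "\<dots> \<le> card (star j) * (k * (k * L))"
    by (rule card_UN_le_mult[OF finite_star]) (rule inner, simp add: star_def)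
  also have "\<dots> \<le> L * n * (k * (k * L))"
    using card_star_le by (rule mult_right_mono) simp
  finally show "card {(i, e, f) \<in> J1. j \<in> U f} \<le> L * n * (k * (k * L))" .
qed

lemma card_J1_le: "card J1 \<le> k\<^sup>2 * L\<^sup>2 * n\<^sup>2"
proof -
  have "J1 \<subseteq> (\<Union>j<n. {(i, e, f) \<in> J1. j \<in> U e})"
    unfolding J1_def J_def star_def by auto
  then have "card J1 \<le> card (\<Union>j<n. {(i, e, f) \<in> J1. j \<in> U e})"
    by (rule card_mono[rotated]) (auto intro: rev_finite_subset[OF finite_J1])
  also have "\<dots> \<le> card {..<n} * (L * n * (k * (k * L)))"
    by (rule card_UN_le_mult) (use card_J1_at in auto)
  also have "\<dots> = k\<^sup>2 * L\<^sup>2 * n\<^sup>2"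
    by (simp add: power2_eq_square algebra_simps)
  finally show ?thesis .
qed

lemma abs_triple_term_le_1: "t \<in> J \<Longrightarrow> \<bar>triple_term t S\<bar> \<le> 1"
  unfolding triple_term_def J_def star_def
  by (auto simp: abs_mult intro!: mult_le_one abs_mon_le_1 abs_c'_le_1 abs_c_le_1)

lemma abs_ev_T1_le: "\<bar>ev T1\<bar> \<le> k\<^sup>2 * L\<^sup>2 * n\<^sup>2"
proof -
  have "\<bar>T1 S\<bar> \<le> card J1" for S
    unfolding T1_def using sum_abs[of "\<lambda>t. triple_term t S" J1]
      sum_bounded_above[of J1 "\<lambda>t. \<bar>triple_term t S\<bar>" 1] abs_triple_term_le_1 J1_subset
    by (smt (verit, best) mult.right_neutral subsetD)
  then have "\<bar>ev T1\<bar> \<le> card J1"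
    using norm_ev_bound_const[of T1 "card J1"] by simp
  also have "\<dots> \<le> real (k\<^sup>2 * L\<^sup>2 * n\<^sup>2)"
    using card_J1_le by (simp only: of_nat_le_iff)
  finally show ?thesis by simp
qed

text \<open>Only triples with \<open>j\<close> in one of their two edges can change, each by at most
  2; by \<open>card_J1_at\<close> there are order \<open>n\<close> of them.\<close>

lemma abs_dif_T1_le:
  assumes "j < n"
  shows "\<bar>dif j T1 S\<bar> \<le> 4 * k\<^sup>2 * L\<^sup>2 * n"
proof -
  let ?K = "{(i, e, f) \<in> J1. j \<in> U e} \<union> {(i, e, f) \<in> J1. j \<in> U f}"
  have K: "?K \<subseteq> J1" by auto
  have "dif j T1 S = (\<Sum>t\<in>J1. dif j (triple_term t) S)"
    unfolding T1_def[abs_def] by (rule dif_sum)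
  also have "\<dots> = (\<Sum>t\<in>?K. dif j (triple_term t) S)"
  proof (rule sum.mono_neutral_right[OF finite_J1 K], rule ballI)
    fix t assume "t \<in> J1 - ?K"
    then show "dif j (triple_term t) S = 0"
      by (cases t) (auto simp: dif_def triple_term_def)
  qed
  finally have "\<bar>dif j T1 S\<bar> \<le> (\<Sum>t\<in>?K. \<bar>dif j (triple_term t) S\<bar>)"
    by simp
  also have "\<dots> \<le> (\<Sum>t\<in>?K. 2)"
  proof (rule sum_mono)
    fix t assume "t \<in> ?K"
    then have t: "t \<in> J"
      using J1_subset by auto
    show "\<bar>dif j (triple_term t) S\<bar> \<le> 2"
      using abs_triple_term_le_1[OF t, of "insert j S"] abs_triple_term_le_1[OF t, of "S - {j}"]
      unfolding dif_def by linarith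
  qed
  also have "\<dots> = 2 * real (card ?K)"
    by simp
  also have "card ?K \<le> L * n * (k * (k * L)) + L * n * (k * (k * L))"
    using card_Un_le card_J1_at[OF assms] by (meson add_mono order_trans)
  finally show ?thesis
    by (simp add: power2_eq_square algebra_simps)
qed

lemma var_T1_le: "ev (\<lambda>S. (T1 S - ev T1)\<^sup>2) \<le> 16 * k ^ 4 * L ^ 4 * n ^ 3"
proof -
  have "ev (\<lambda>S. (T1 S - ev T1)\<^sup>2) \<le>
      (ev (\<lambda>S. T1 S - ev T1))\<^sup>2 + (\<Sum>j<n. ev (\<lambda>S. (dif j (\<lambda>S. T1 S - ev T1) S)\<^sup>2))"
    by (rule poincare)
  also have "ev (\<lambda>S. T1 S - ev T1) = 0"
    by (simp add: ev_diff)
  also have "0\<^sup>2 + (\<Sum>j<n. ev (\<lambda>S. (dif j (\<lambda>S. T1 S - ev T1) S)\<^sup>2))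
      \<le> 0\<^sup>2 + (\<Sum>j<n. (real (4 * k\<^sup>2 * L\<^sup>2 * n))\<^sup>2)"
  proof (intro add_left_mono sum_mono)
    fix j assume "j \<in> {..<n}"
    then have "\<bar>dif j (\<lambda>S. T1 S - ev T1) S\<bar> \<le> 4 * k\<^sup>2 * L\<^sup>2 * n" for S
      using abs_dif_T1_le[of j S] by (simp add: dif_def)
    then have "(dif j (\<lambda>S. T1 S - ev T1) S)\<^sup>2 \<le> (real (4 * k\<^sup>2 * L\<^sup>2 * n))\<^sup>2" for S
      by (metis abs_ge_zero power2_abs power_mono)
    then show "ev (\<lambda>S. (dif j (\<lambda>S. T1 S - ev T1) S)\<^sup>2) \<le> (real (4 * k\<^sup>2 * L\<^sup>2 * n))\<^sup>2"
      using ev_mono[of "\<lambda>S. (dif j (\<lambda>S. T1 S - ev T1) S)\<^sup>2" "\<lambda>_. (real (4 * k\<^sup>2 * L\<^sup>2 * n))\<^sup>2"]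
      by simp
  qed
  also have "\<dots> = 16 * k ^ 4 * L ^ 4 * n ^ 3"
    by (simp add: power2_eq_square power4_eq_xxxx power3_eq_cube algebra_simps)
  finally show ?thesis .
qed

lemma card_J_le: "card J \<le> L\<^sup>2 * n ^ 3"
proof -
  have "card J = (\<Sum>i<n. card (star i) * card (star i))"
    unfolding J_def by (simp add: card_SigmaI finite_star card_cartesian_product)
  also have "\<dots> \<le> (\<Sum>i<n. (L * n) * (L * n))"
    by (intro sum_mono mult_mono card_star_le) auto
  finally show ?thesis
    by (simp add: power2_eq_square power3_eq_cube algebra_simps)
qed

text \<open>Each support arises from boundedly many triples, so orthogonality bounds the second
  moment by a multiple of the number of triples, which is of order \<open>n ^ 3\<close>.\<close>

lemma ev_T2_sq_le: "ev (\<lambda>S. (T2 S)\<^sup>2) \<le> 16 * k ^ 5 * L ^ 4 * n ^ 3"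
proof -
  define A where "A = (\<lambda>(i, e, f). (U e - {i}) \<union> (U f - {i}))"
  define d where "d = (\<lambda>(i :: nat, e, f). c' e * c f)"
  have T2: "T2 S = (\<Sum>t\<in>J - J1. d t * mon (A t) S)" for S
    unfolding T2_def
  proof (rule sum.cong)
    fix t assume "t \<in> J - J1"
    then obtain i e f where t: "t = (i, e, f)" and ef: "e \<in> I" "f \<in> I"
      and disj: "(U e - {i}) \<inter> (U f - {i}) = {}"
      by (cases t) (auto simp: J1_def J_def star_def)
    have "mon (A t) S = mon (U e - {i}) S * mon (U f - {i}) S"
      unfolding t A_def mon_def prod.case
      by (rule prod.union_disjoint) (use ef finite_U disj in auto)
    then show "triple_term t S = d t * mon (A t) S"
      by (simp add: t d_def triple_term_def)
  qed simp
  have "ev (\<lambda>S. (T2 S)\<^sup>2) \<le> real (16 * k ^ 5 * L\<^sup>2) * card (J - J1)"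
    unfolding T2
  proof (rule ev_sum_mon_sq_le)
    show "finite (J - J1)"
      using finite_J by simp
  next
    fix t assume "t \<in> J - J1"
    then show "A t \<subseteq> {..<n}" "\<bar>d t\<bar> \<le> 1"
      using U_subset abs_c_le_1 abs_c'_le_1
      by (auto simp: A_def d_def J_def star_def abs_mult mult_le_one)
  next
    fix t assume t: "t \<in> J - J1"
    \<comment> \<open>The edges with two points in \<open>A t\<close>. Both edges of any triple with
      this union belong to \<open>H\<close>, since each keeps two points after \<open>i\<close> is
      removed.\<close>
    define H where "H = (\<Union>a\<in>A t. \<Union>b\<in>A t - {a}. {e \<in> I. a \<in> U e \<and> b \<in> U e})"
    have fin: "finite (A t)" and cardA: "card (A t) \<le> 2 * k"
    proof -
      obtain i e f where t': "t = (i, e, f)" "e \<in> I" "f \<in> I"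
        using t by (cases t) (auto simp: J_def star_def)
      then show "finite (A t)"
        by (simp add: A_def finite_U)
      have "card (A t) \<le> card (U e - {i}) + card (U f - {i})"
        unfolding A_def t' by (simp add: card_Un_le)
      also have "\<dots> \<le> card (U e) + card (U f)"
        by (intro add_mono card_Diff1_le)
      finally show "card (A t) \<le> 2 * k"
        using card_U_le[OF t'(2)] card_U_le[OF t'(3)] by linarith
    qed
    have "card H \<le> card (A t) * (2 * k * L)"
      unfolding H_def
    proof (rule card_UN_le_mult[OF fin])
      fix a
      have "card (\<Union>b\<in>A t - {a}. {e \<in> I. a \<in> U e \<and> b \<in> U e}) \<le> card (A t - {a}) * L"
        by (rule card_UN_le_mult) (use fin pair_degree in auto)
      also have "\<dots> \<le> 2 * k * L"
        using card_Diff1_le[of "A t" a] cardA by (intro mult_right_mono) auto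
      finally show "card (\<Union>b\<in>A t - {a}. {e \<in> I. a \<in> U e \<and> b \<in> U e}) \<le> 2 * k * L" .
    qed
    also have "\<dots> \<le> 2 * k * (2 * k * L)"
      using cardA by (rule mult_right_mono) simp
    finally have cardH: "card H \<le> 2 * k * (2 * k * L)" .
    have HI: "H \<subseteq> I" and finH: "finite H"
      using finite_I fin unfolding H_def by auto
    let ?B = "\<Union>e\<in>H. \<Union>f\<in>H. \<Union>i\<in>U e. {(i, e, f)}"
    have "{s \<in> J - J1. A s = A t} \<subseteq> ?B"
    proof
      fix s assume s: "s \<in> {s \<in> J - J1. A s = A t}"
      then obtain i e f where s': "s = (i, e, f)" "e \<in> I" "f \<in> I" "i \<in> U e"
        by (cases s) (auto simp: J_def star_def)
      have As: "A t = (U e - {i}) \<union> (U f - {i})"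
        using s s' by (simp add: A_def)
      have "e \<in> H"
        by (rule two_other[OF s'(2), of i]) (use As s' in \<open>auto simp: H_def\<close>)
      moreover have "f \<in> H"
        by (rule two_other[OF s'(3), of i]) (use As s' in \<open>auto simp: H_def\<close>)
      ultimately show "s \<in> ?B"
        using s' by auto
    qed
    then have "card {s \<in> J - J1. A s = A t} \<le> card ?B"
      by (rule card_mono[rotated]) (use finH HI finite_U in auto)
    also have "\<dots> \<le> card H * (card H * (k * 1))"
    proof (rule card_UN_le_mult[OF finH])
      fix e assume e: "e \<in> H"
      show "card (\<Union>f\<in>H. \<Union>i\<in>U e. {(i, e, f)}) \<le> card H * (k * 1)"
      proof (rule card_UN_le_mult[OF finH])
        fix f assume f: "f \<in> H"
        have "card (\<Union>i\<in>U e. {(i, e, f)}) \<le> card (U e) * 1"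
          by (rule card_UN_le_mult) (use e HI finite_U in auto)
        then show "card (\<Union>i\<in>U e. {(i, e, f)}) \<le> k * 1"
          using card_U_le[of e] e HI by auto
      qed
    qed
    also have "\<dots> \<le> (2 * k * (2 * k * L)) * ((2 * k * (2 * k * L)) * (k * 1))"
      using cardH by (intro mult_mono) auto
    also have "\<dots> = 16 * k ^ 5 * L\<^sup>2"
      by (simp add: power2_eq_square eval_nat_numeral algebra_simps)
    finally show "real (card {s \<in> J - J1. A s = A t}) \<le> real (16 * k ^ 5 * L\<^sup>2)"
      by (simp only: of_nat_le_iff)
  qed
  also have "\<dots> \<le> real (16 * k ^ 5 * L\<^sup>2) * real (L\<^sup>2 * n ^ 3)"
    using order_trans[OF card_mono[OF finite_J, of "J - J1"] card_J_le]
    by (intro mult_left_mono of_nat_mono) auto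
  finally show ?thesis
    by (simp add: power2_eq_square power4_eq_xxxx algebra_simps)
qed

end

section \<open>The characteristic function\<close>

lemma cis_approx: "cmod (cis x - 1 - \<i> * x) \<le> x\<^sup>2 / 2"
  using iexp_approx1[of x 1] by (simp add: cis_conv_exp power2_eq_square algebra_simps)

lemma norm_cis_diff_le: "cmod (cis a - cis b) \<le> \<bar>a - b\<bar>"
proof -
  have "cis a - cis b = cis b * (cis (a - b) - 1)"
    by (simp add: algebra_simps cis_mult)
  then have "cmod (cis a - cis b) = cmod (cis (a - b) - 1)"
    by (simp add: norm_mult)
  also have "\<dots> \<le> \<bar>a - b\<bar>"
    using iexp_approx1[of "a - b" 0] by (simp add: cis_conv_exp)
  finally show ?thesis .
qed

text \<open>Either endpoint may be the base point, because \<open>Y S\<close> is one of the two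
  values compared, depending on whether \<open>i \<in> S\<close>.\<close>

lemma norm_cis_diff_approx_le:
  assumes "s = a \<or> s = b"
  shows "cmod (cis a - cis b - \<i> * (a - b) * cis s) \<le> (a - b)\<^sup>2 / 2"
proof -
  have *: "cmod (cis a - cis b - \<i> * (a - b) * cis b) \<le> (a - b)\<^sup>2 / 2" for a b :: real
  proof -
    have "cis a - cis b - \<i> * (a - b) * cis b = cis b * (cis (a - b) - 1 - \<i> * (a - b))"
      by (simp add: algebra_simps cis_mult)
    then show ?thesis
      using cis_approx[of "a - b"] by (simp add: norm_mult)
  qed
  show ?thesis
    using assms
  proof
    assume "s = a"
    then have "cis a - cis b - \<i> * (a - b) * cis s = - (cis b - cis a - \<i> * (b - a) * cis a)"
      by (simp add: algebra_simps)
    then show ?thesis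
      using *[of b a] by (simp only: norm_minus_cancel) (simp add: power2_commute)
  qed (use * in simp)
qed

lemma onorm_scaleR_right_le:
  fixes x :: "'a::real_normed_vector"
  assumes "norm x \<le> b"
  shows "onorm (\<lambda>h. h *\<^sub>R x) \<le> b"
proof (rule onorm_le)
  fix h :: real
  show "norm (h *\<^sub>R x) \<le> b * norm h"
    using mult_right_mono[OF assms, of "\<bar>h\<bar>"] by (simp add: mult.commute)
qed

context bernoulli_subset
begin

text \<open>The inequality of arithmetic and geometric means replaces Cauchy-Schwarz;
  \<open>\<delta>\<close> is meant to have the order of the standard deviation.\<close>

lemma ev_abs_le:
  fixes F :: "nat set \<Rightarrow> real"
  assumes "0 < \<delta>"
  shows "ev (\<lambda>S. \<bar>F S\<bar>) \<le> (\<delta> + ev (\<lambda>S. (F S)\<^sup>2) / \<delta>) / 2"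
proof -
  have "ev (\<lambda>S. \<bar>F S\<bar>) \<le> ev (\<lambda>S. 1 / 2 * (\<delta> + 1 / \<delta> * (F S)\<^sup>2))"
  proof (rule ev_mono)
    fix S
    show "\<bar>F S\<bar> \<le> 1 / 2 * (\<delta> + 1 / \<delta> * (F S)\<^sup>2)"
      using sum_squares_bound[of \<delta> "\<bar>F S\<bar>"] assms by (simp add: field_simps power2_eq_square)
  qed
  then show ?thesis
    by (simp only: ev_mult_left ev_add ev_const) simp
qed

lemma ev_has_vector_derivative:
  fixes F :: "real \<Rightarrow> nat set \<Rightarrow> 'a::real_normed_vector"
  assumes "\<And>S. ((\<lambda>t. F t S) has_vector_derivative F' S) (at t within A)"
  shows "((\<lambda>t. ev (F t)) has_vector_derivative ev F') (at t within A)"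
  unfolding ev_def using assms
  by (intro has_vector_derivative_sum bounded_linear.has_vector_derivative[OF bounded_linear_scaleR_right])

end

section \<open>Differential equation for the characteristic function\<close>

context edge_family
begin

definition chf :: "real \<Rightarrow> complex" where
  "chf t = ev (\<lambda>S. cis (t * Y S / n))"

text \<open>Taking \<open>G = Y\<close> in \<open>ev_Y_mult\<close> shows that this is the second
  moment of \<open>Y / n\<close>, as the monomials in \<open>T2\<close> have mean zero. It acts as
  the variance of the approximating Gaussian.\<close>

definition rate :: real where
  "rate = v * ev T1 / n\<^sup>2"

text \<open>The sum of the two coefficients in \<open>norm_chf_deriv_le\<close>.\<close>

definition C :: real where
  "C = 6 * L ^ 4 + (1 + 16 * k ^ 5 * L ^ 4)"

lemma chf_0: "chf 0 = 1"
  by (simp add: chf_def)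

lemma chf_has_vector_derivative:
  "(chf has_vector_derivative \<i> / n * ev (\<lambda>S. Y S *\<^sub>R cis (t * Y S / n))) (at t within A)"
proof -
  have "((\<lambda>t. ev (\<lambda>S. cis (t * Y S / n))) has_vector_derivative
      ev (\<lambda>S. (Y S / n) *\<^sub>R (\<i> * cis (t * Y S / n)))) (at t within A)"
  proof (rule ev_has_vector_derivative)
    fix S
    have "((\<lambda>t. t * Y S / n) has_derivative (\<lambda>h. h * (Y S / n))) (at t within A)"
      using bounded_linear_imp_has_derivative[OF bounded_linear_mult_left, of "Y S / n"] by simp
    from has_derivative_cis[OF this]
    show "((\<lambda>t. cis (t * Y S / n)) has_vector_derivative (Y S / n) *\<^sub>R (\<i> * cis (t * Y S / n))) (at t within A)"
      by (simp add: has_vector_derivative_def)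
  qed
  also have "(\<lambda>S. (Y S / n) *\<^sub>R (\<i> * cis (t * Y S / n))) = (\<lambda>S. \<i> / n * (Y S *\<^sub>R cis (t * Y S / n)))"
    by (auto simp: scaleR_conv_of_real)
  also have "ev \<dots> = \<i> / n * ev (\<lambda>S. Y S *\<^sub>R cis (t * Y S / n))"
    by (rule ev_mult_left)
  finally show ?thesis
    unfolding chf_def[abs_def] .
qed

text \<open>The weight \<open>sqrt n\<close> in the arithmetic-geometric mean inequality balances
  the second moment, of order \<open>n\<close>, against the fourth, of order
  \<open>n\<^sup>2\<close>.\<close>

lemma ev_link_cubic_le:
  assumes "0 < n"
  shows "ev (\<lambda>S. \<bar>link c' i S\<bar> * (link c i S)\<^sup>2) \<le> 6 * L ^ 4 * (n * sqrt n)"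
proof -
  let ?s = "sqrt n"
  have s: "0 < ?s" "?s * ?s = n"
    using assms by auto
  have "ev (\<lambda>S. \<bar>link c' i S\<bar> * (link c i S)\<^sup>2)
      \<le> ev (\<lambda>S. 1 / 2 * (?s * (link c' i S)\<^sup>2 + 1 / ?s * (link c i S) ^ 4))"
  proof (rule ev_mono)
    fix S
    have "?s * (2 * \<bar>link c' i S\<bar> * (link c i S)\<^sup>2) = 2 * (?s * \<bar>link c' i S\<bar>) * (link c i S)\<^sup>2"
      by simp
    also have "\<dots> \<le> (?s * \<bar>link c' i S\<bar>)\<^sup>2 + ((link c i S)\<^sup>2)\<^sup>2"
      by (rule sum_squares_bound)
    also have "\<dots> = ?s * (?s * (link c' i S)\<^sup>2 + 1 / ?s * (link c i S) ^ 4)"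
      using s(1) by (simp add: power2_eq_square power4_eq_xxxx algebra_simps)
    finally have "2 * \<bar>link c' i S\<bar> * (link c i S)\<^sup>2 \<le> ?s * (link c' i S)\<^sup>2 + 1 / ?s * (link c i S) ^ 4"
      using s(1) by (rule mult_left_le_imp_le)
    then show "\<bar>link c' i S\<bar> * (link c i S)\<^sup>2
        \<le> 1 / 2 * (?s * (link c' i S)\<^sup>2 + 1 / ?s * (link c i S) ^ 4)"
      by simp
  qed
  also have "\<dots> = 1 / 2 * (?s * ev (\<lambda>S. (link c' i S)\<^sup>2) + 1 / ?s * ev (\<lambda>S. (link c i S) ^ 4))"
    by (simp only: ev_mult_left ev_add)
  also have "\<dots> \<le> 1 / 2 * (?s * (L\<^sup>2 * n) + 1 / ?s * (11 * L ^ 4 * n\<^sup>2))"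
    using s by (intro mult_left_mono add_mono ev_link_sq_le ev_link_pow4_le abs_c_le_1 abs_c'_le_1) auto
  also have "1 / ?s * (11 * L ^ 4 * n\<^sup>2) = 11 * L ^ 4 * (n * ?s)"
  proof -
    have "(real n)\<^sup>2 = ?s * (n * ?s)"
      using s(2) by (simp add: power2_eq_square mult.commute mult.left_commute)
    then have "1 / ?s * (11 * L ^ 4 * (real n)\<^sup>2) = 11 * L ^ 4 * (n * ?s)"
      using s(1) by (simp only:) simp
    then show ?thesis
      by simp
  qed
  also have "1 / 2 * (?s * (L\<^sup>2 * n) + 11 * L ^ 4 * (n * ?s)) = (real L ^ 2 + 11 * real L ^ 4) / 2 * (n * ?s)"
    by (simp add: algebra_simps)
  also have "\<dots> \<le> 6 * real L ^ 4 * (n * ?s)"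
  proof (rule mult_right_mono)
    have "real L ^ 2 \<le> real L ^ 4"
      using L_pos by (intro power_increasing) auto
    then show "(real L ^ 2 + 11 * real L ^ 4) / 2 \<le> 6 * real L ^ 4"
      by simp
  qed simp
  finally show ?thesis by simp
qed

lemma ev_T_deviation_le:
  assumes "0 < n"
  shows "ev (\<lambda>S. \<bar>T1 S - ev T1\<bar>) + ev (\<lambda>S. \<bar>T2 S\<bar>) \<le> (1 + 16 * k ^ 5 * L ^ 4) * (n * sqrt n)"
proof -
  let ?\<delta> = "n * sqrt n"
  have \<delta>: "0 < ?\<delta>" "real n ^ 3 = ?\<delta> * ?\<delta>"
    using assms by (auto simp: power3_eq_cube mult.commute mult.left_commute)
  \<comment> \<open>\<open>\<delta>\<close> matches the bounds on the standard deviations of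
    \<open>T1\<close> and \<open>T2\<close>. The exponent \<open>m\<close> is 4 for
    \<open>T1\<close> and 5 for \<open>T2\<close>.\<close>
  have bound: "ev (\<lambda>S. \<bar>F S\<bar>) \<le> (1 + 16 * k ^ 5 * L ^ 4) * ?\<delta> / 2"
    if "ev (\<lambda>S. (F S)\<^sup>2) \<le> 16 * real k ^ m * L ^ 4 * n ^ 3" "m = 4 \<or> m = 5" for F m
  proof -
    have km: "real k ^ m \<le> real k ^ 5"
      using that(2) by (cases "k = 0") (auto intro!: power_increasing)
    have "ev (\<lambda>S. \<bar>F S\<bar>) \<le> (?\<delta> + ev (\<lambda>S. (F S)\<^sup>2) / ?\<delta>) / 2"
      by (rule ev_abs_le) fact
    also have "\<dots> \<le> (?\<delta> + 16 * real k ^ 5 * L ^ 4 * ?\<delta>) / 2"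
    proof -
      have "ev (\<lambda>S. (F S)\<^sup>2) \<le> 16 * real k ^ 5 * L ^ 4 * n ^ 3"
        using that(1) by (rule order_trans) (use km in \<open>intro mult_right_mono mult_left_mono; simp\<close>)
      then have "ev (\<lambda>S. (F S)\<^sup>2) / ?\<delta> \<le> 16 * real k ^ 5 * L ^ 4 * (?\<delta> * ?\<delta>) / ?\<delta>"
        unfolding of_nat_power \<delta>(2) using \<delta>(1) by (intro divide_right_mono) auto
      also have "\<dots> = 16 * real k ^ 5 * L ^ 4 * ?\<delta>"
        using \<delta>(1) by (simp del: real_sqrt_mult_self)
      finally show ?thesis
        by (intro divide_right_mono add_left_mono) auto
    qed
    also have "\<dots> = (1 + 16 * k ^ 5 * L ^ 4) * ?\<delta> / 2"
      by (simp add: algebra_simps)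
    finally show ?thesis .
  qed
  show ?thesis
    using bound[of "\<lambda>S. T1 S - ev T1" 4] bound[of T2 5] var_T1_le ev_T2_sq_le by simp
qed

text \<open>Approximately \<open>chf' = - rate * t * chf\<close>, the differential equation of a Gaussian characteristic
  function.\<close>

lemma norm_chf_deriv_le:
  fixes t :: real
  assumes "0 < n" "0 \<le> t"
  shows "cmod (\<i> / n * ev (\<lambda>S. Y S *\<^sub>R cis (t * Y S / n)) + t * rate * chf t)
    \<le> (6 * L ^ 4 * t\<^sup>2 + (1 + 16 * k ^ 5 * L ^ 4) * t) / sqrt n"
proof -
  define G where "G S = cis (t * Y S / n)" for S
  \<comment> \<open>The remainder of the chain rule for the discrete derivative of \<open>G\<close>,
    of second order in the link.\<close>
  define R where "R i S = dif i G S - \<i> * (t / n) * link c i S * G S" for i S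
  let ?m = "ev T1"
  have R: "cmod (R i S) \<le> (t / n)\<^sup>2 * (link c i S)\<^sup>2" for i S
  proof -
    let ?a = "t * Y (insert i S) / n" and ?b = "t * Y (S - {i}) / n"
    have "?a - ?b = t / n * link c i S"
      using dif_Y[of i S] by (simp add: dif_def algebra_simps flip: diff_divide_distrib)
    moreover have "cmod (cis ?a - cis ?b - \<i> * (?a - ?b) * G S) \<le> (?a - ?b)\<^sup>2 / 2"
      unfolding G_def by (rule norm_cis_diff_approx_le) (use dif_eq_cases[of Y S i] in auto)
    ultimately have "cmod (R i S) \<le> (t / n * link c i S)\<^sup>2 / 2"
      unfolding R_def by (simp add: dif_def G_def mult.assoc)
    also have "\<dots> \<le> (t / n * link c i S)\<^sup>2"
      by simp
    finally show ?thesis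
      by (simp add: power_mult_distrib power_divide)
  qed
  have "(\<Sum>i<n. ev (\<lambda>S. link c' i S *\<^sub>R dif i G S))
      = (\<Sum>i<n. ev (\<lambda>S. \<i> * (t / n) * ((link c' i S * link c i S) *\<^sub>R G S) + link c' i S *\<^sub>R R i S))"
    by (simp add: R_def scaleR_conv_of_real algebra_simps)
  also have "\<dots> = \<i> * (t / n) * ev (\<lambda>S. \<Sum>i<n. (link c' i S * link c i S) *\<^sub>R G S)
      + (\<Sum>i<n. ev (\<lambda>S. link c' i S *\<^sub>R R i S))"
    by (simp only: ev_add ev_mult_left ev_sum sum.distrib sum_distrib_left)
  also have "ev (\<lambda>S. \<Sum>i<n. (link c' i S * link c i S) *\<^sub>R G S)
      = ev (\<lambda>S. ?m *\<^sub>R G S + ((T1 S - ?m) *\<^sub>R G S + T2 S *\<^sub>R G S))"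
    unfolding scaleR_sum_left[symmetric] sum_link_mult
    by (simp flip: scaleR_add_left)
  also have "\<dots> = ?m *\<^sub>R chf t + (ev (\<lambda>S. (T1 S - ?m) *\<^sub>R G S) + ev (\<lambda>S. T2 S *\<^sub>R G S))"
    by (simp add: ev_add ev_scaleR chf_def G_def)
  finally have main: "ev (\<lambda>S. Y S *\<^sub>R G S) = v *\<^sub>R (\<i> * (t / n) * (?m *\<^sub>R chf t
      + (ev (\<lambda>S. (T1 S - ?m) *\<^sub>R G S) + ev (\<lambda>S. T2 S *\<^sub>R G S)))
      + (\<Sum>i<n. ev (\<lambda>S. link c' i S *\<^sub>R R i S)))"
    unfolding ev_Y_mult by simp
  \<comment> \<open>\<open>E1\<close> collects the fluctuation of the quadratic form around its
    mean, \<open>E2\<close> the chain rule remainders. Their bounds are smaller than that of the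
    main term by a factor of order \<open>sqrt n\<close>.\<close>
  define E1 where "E1 = ev (\<lambda>S. (T1 S - ?m) *\<^sub>R G S) + ev (\<lambda>S. T2 S *\<^sub>R G S)"
  define E2 where "E2 = (\<Sum>i<n. ev (\<lambda>S. link c' i S *\<^sub>R R i S))"
  have E1: "cmod E1 \<le> (1 + 16 * k ^ 5 * L ^ 4) * (n * sqrt n)"
  proof -
    have "cmod E1 \<le> ev (\<lambda>S. \<bar>T1 S - ?m\<bar>) + ev (\<lambda>S. \<bar>T2 S\<bar>)"
      unfolding E1_def by (rule norm_triangle_mono; rule norm_ev_bound) (simp_all add: G_def)
    then show ?thesis
      using ev_T_deviation_le[OF assms(1)] by linarith
  qed
  have E2: "cmod E2 \<le> 6 * L ^ 4 * t\<^sup>2 * sqrt n"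
  proof -
    have "cmod E2 \<le> (\<Sum>i<n. (t / n)\<^sup>2 * (6 * L ^ 4 * (n * sqrt n)))"
      unfolding E2_def
    proof (rule sum_norm_le)
      fix i
      have "cmod (ev (\<lambda>S. link c' i S *\<^sub>R R i S)) \<le> ev (\<lambda>S. (t / n)\<^sup>2 * (\<bar>link c' i S\<bar> * (link c i S)\<^sup>2))"
      proof (rule norm_ev_bound)
        fix S
        have "cmod (link c' i S *\<^sub>R R i S) \<le> \<bar>link c' i S\<bar> * ((t / n)\<^sup>2 * (link c i S)\<^sup>2)"
          unfolding norm_scaleR by (rule mult_left_mono[OF R]) simp
        then show "cmod (link c' i S *\<^sub>R R i S) \<le> (t / n)\<^sup>2 * (\<bar>link c' i S\<bar> * (link c i S)\<^sup>2)"
          by (simp only: mult.left_commute)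
      qed
      also have "\<dots> \<le> (t / n)\<^sup>2 * (6 * L ^ 4 * (n * sqrt n))"
        unfolding ev_mult_left by (rule mult_left_mono[OF ev_link_cubic_le[OF assms(1)]]) simp
      finally show "cmod (ev (\<lambda>S. link c' i S *\<^sub>R R i S)) \<le> (t / n)\<^sup>2 * (6 * L ^ 4 * (n * sqrt n))" .
    qed
    also have "\<dots> = 6 * L ^ 4 * t\<^sup>2 * sqrt n"
      using assms(1) by (simp add: field_simps power2_eq_square)
    finally show ?thesis .
  qed
  have "\<i> / n * ev (\<lambda>S. Y S *\<^sub>R G S) + t * rate * chf t = v * (\<i> * (\<i> * (t / n\<^sup>2)) * E1 + \<i> / n * E2)"
  proof -
    have ev_eq: "ev (\<lambda>S. Y S *\<^sub>R G S) = v * (\<i> * (t / n) * (?m * chf t + E1) + E2)"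
      unfolding main E1_def E2_def by (simp add: scaleR_conv_of_real)
    define w where "w = 1 / complex_of_real n"
    \<comment> \<open>With \<open>1 / n\<close> and the imaginary unit as letters, this is a
      polynomial identity modulo \<open>j * j = -1\<close>.\<close>
    have alg: "j * w * (a * (j * (b * w) * (m * f + x) + z)) + b * (a * m * (w * w)) * f
        = a * (j * (j * (b * (w * w))) * x + j * w * z)" if "j * j = -1" for j a b m f x z :: complex
      using that by algebra
    show ?thesis
      using alg[of \<i> v t "ev T1" "chf t" E1 E2]
      unfolding ev_eq rate_def w_def by (simp add: power2_eq_square)
  qed
  also have "cmod \<dots> \<le> 1 * (t / n\<^sup>2 * cmod E1 + 1 / n * cmod E2)"
    unfolding norm_mult[of "of_real v"]
  proof (rule mult_mono)
    have "cmod (\<i> * (\<i> * (t / n\<^sup>2)) * E1 + \<i> / n * E2)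
        \<le> cmod (\<i> * (\<i> * (t / n\<^sup>2)) * E1) + cmod (\<i> / n * E2)"
      by (rule norm_triangle_ineq)
    also have "\<dots> = t / n\<^sup>2 * cmod E1 + 1 / n * cmod E2"
      using assms(2) by (simp add: norm_mult norm_divide norm_power)
    finally show "cmod (\<i> * (\<i> * (t / n\<^sup>2)) * E1 + \<i> / n * E2) \<le> t / n\<^sup>2 * cmod E1 + 1 / n * cmod E2" .
  qed (use v_pos v_le_1 in auto)
  also have "\<dots> \<le> 1 * (t / n\<^sup>2 * ((1 + 16 * k ^ 5 * L ^ 4) * (n * sqrt n)) + 1 / n * (6 * L ^ 4 * t\<^sup>2 * sqrt n))"
    using E1 E2 assms by (intro mult_left_mono add_mono) auto
  also have "\<dots> = (6 * L ^ 4 * t\<^sup>2 + (1 + 16 * k ^ 5 * L ^ 4) * t) * (sqrt n / n)"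
    using assms(1) by (simp add: field_simps power2_eq_square)
  also have "sqrt n / n = 1 / sqrt n"
    using assms(1) by (simp add: real_div_sqrt field_simps)
  finally show ?thesis
    by (simp add: G_def)
qed

lemma abs_rate_le: "\<bar>rate\<bar> \<le> k\<^sup>2 * L\<^sup>2"
proof -
  have "v * \<bar>ev T1\<bar> \<le> 1 * real (k\<^sup>2 * L\<^sup>2 * n\<^sup>2)"
    using abs_ev_T1_le v_pos v_le_1 by (intro mult_mono) auto
  then have "v * \<bar>ev T1\<bar> / (real n)\<^sup>2 \<le> real (k\<^sup>2 * L\<^sup>2 * n\<^sup>2) / (real n)\<^sup>2"
    by (simp only: mult_1 divide_right_mono zero_le_power2)
  moreover have "\<bar>rate\<bar> = v * \<bar>ev T1\<bar> / (real n)\<^sup>2"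
    using v_pos by (simp add: rate_def abs_mult)
  ultimately have "\<bar>rate\<bar> \<le> k\<^sup>2 * L\<^sup>2 * n\<^sup>2 / (real n)\<^sup>2"
    by simp
  then show ?thesis
    by (cases "n = 0") (auto intro: order_trans)
qed

text \<open>The integrating factor \<open>exp (rate * s\<^sup>2 / 2)\<close> turns the approximate
  differential equation into a small derivative of \<open>\<psi>\<close>, so \<open>\<psi> t\<close>
  stays within \<open>1 / 2\<close> of \<open>\<psi> 0 = 1\<close>. The factor itself is at most
  \<open>exp K\<close>.\<close>

lemma chf_lower_bound:
  fixes t T :: real
  assumes T: "1 \<le> T" "0 \<le> t" "t \<le> T" "0 < n"
    and large: "2 * (exp (k\<^sup>2 * L\<^sup>2 * T\<^sup>2) * (C * T ^ 3)) \<le> sqrt n"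
  shows "exp (- (k\<^sup>2 * L\<^sup>2 * T\<^sup>2)) / 2 \<le> cmod (chf t)"
proof -
  define K where "K = k\<^sup>2 * L\<^sup>2 * T\<^sup>2"
  define \<psi> where "\<psi> s = exp (rate * s\<^sup>2 / 2) *\<^sub>R chf s" for s
  define B where "B = exp K * (C * T\<^sup>2 / sqrt n)"
  have rate_K: "\<bar>rate * s\<^sup>2 / 2\<bar> \<le> K" if "0 \<le> s" "s \<le> T" for s
  proof -
    have "\<bar>rate * s\<^sup>2 / 2\<bar> \<le> \<bar>rate\<bar> * s\<^sup>2"
      by (simp add: abs_mult)
    also have "\<dots> \<le> K"
      unfolding K_def using abs_rate_le that
      by (intro mult_mono power_mono) auto
    finally show ?thesis .
  qed
  have deriv: "(\<psi> has_vector_derivative exp (rate * s\<^sup>2 / 2) *\<^sub>R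
      (\<i> / n * ev (\<lambda>S. Y S *\<^sub>R cis (s * Y S / n)) + s * rate * chf s)) (at s within {0..T})" for s
  proof -
    have "((\<lambda>s. exp (rate * s\<^sup>2 / 2)) has_real_derivative exp (rate * s\<^sup>2 / 2) * (rate * s)) (at s within {0..T})"
      by (auto intro!: derivative_eq_intros)
    from has_vector_derivative_scaleR[OF this chf_has_vector_derivative]
    show ?thesis
      unfolding \<psi>_def[abs_def] by (simp add: scaleR_conv_of_real algebra_simps)
  qed
  have "norm (\<psi> t - \<psi> 0) \<le> B * norm (t - 0)"
  proof (rule differentiable_bound)
    show "(\<psi> has_derivative (\<lambda>h. h *\<^sub>R (exp (rate * s\<^sup>2 / 2) *\<^sub>R
      (\<i> / n * ev (\<lambda>S. Y S *\<^sub>R cis (s * Y S / n)) + s * rate * chf s)))) (at s within {0..T})" for s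
      using deriv[of s] by (simp only: has_vector_derivative_def)
    fix s assume s: "s \<in> {0..T}"
    have "cmod (\<i> / n * ev (\<lambda>S. Y S *\<^sub>R cis (s * Y S / n)) + s * rate * chf s)
        \<le> (6 * L ^ 4 * s\<^sup>2 + (1 + 16 * k ^ 5 * L ^ 4) * s) / sqrt n"
      by (rule norm_chf_deriv_le) (use T s in auto)
    also have "\<dots> \<le> (6 * L ^ 4 * T\<^sup>2 + (1 + 16 * k ^ 5 * L ^ 4) * T\<^sup>2) / sqrt n"
    proof -
      have "s\<^sup>2 \<le> T\<^sup>2"
        using s by (auto intro: power_mono)
      \<comment> \<open>This step needs \<open>1 \<le> T\<close>, which is why \<open>T0\<close> is
        a maximum with 1.\<close>
      moreover have "s \<le> T\<^sup>2"
        using s T self_le_power[of T 2] by auto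
      ultimately show ?thesis
        by (intro divide_right_mono add_mono mult_left_mono) auto
    qed
    also have "\<dots> = C * T\<^sup>2 / sqrt n"
      by (simp add: C_def algebra_simps)
    finally have bd: "cmod (\<i> / n * ev (\<lambda>S. Y S *\<^sub>R cis (s * Y S / n)) + s * rate * chf s) \<le> C * T\<^sup>2 / sqrt n" .
    have "exp (rate * s\<^sup>2 / 2) \<le> exp K"
      using rate_K[of s] s by auto
    with bd have "norm (exp (rate * s\<^sup>2 / 2) *\<^sub>R
      (\<i> / n * ev (\<lambda>S. Y S *\<^sub>R cis (s * Y S / n)) + s * rate * chf s)) \<le> B"
      unfolding B_def norm_scaleR by (intro mult_mono) auto
    then show "onorm (\<lambda>h. h *\<^sub>R (exp (rate * s\<^sup>2 / 2) *\<^sub>R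
      (\<i> / n * ev (\<lambda>S. Y S *\<^sub>R cis (s * Y S / n)) + s * rate * chf s))) \<le> B"
      by (rule onorm_scaleR_right_le)
  qed (use T in auto)
  also have "B * norm (t - 0) \<le> B * T"
  proof -
    have "0 \<le> B"
      unfolding B_def C_def by simp
    then show ?thesis
      using T by (intro mult_left_mono) auto
  qed
  also have "B * T = exp K * (C * T ^ 3) / sqrt n"
    by (simp add: B_def power2_eq_square power3_eq_cube)
  also have "\<dots> \<le> 1 / 2"
    using large T(4) by (simp add: K_def divide_le_eq)
  finally have "norm (\<psi> t - 1) \<le> 1 / 2"
    by (simp add: \<psi>_def chf_0)
  then have "1 / 2 \<le> norm (\<psi> t)"
    using norm_triangle_ineq2[of 1 "1 - \<psi> t"] by (simp add: norm_minus_commute)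
  also have "norm (\<psi> t) = exp (rate * t\<^sup>2 / 2) * cmod (chf t)"
    by (simp add: \<psi>_def)
  also have "\<dots> \<le> exp K * cmod (chf t)"
    using rate_K[of t] T by (intro mult_right_mono) auto
  finally show ?thesis
    by (simp add: K_def exp_minus field_simps)
qed

end

section \<open>Oscillating Gaussian sums\<close>

text \<open>Multiplication by \<open>1 - w\<close> telescopes the geometric factor, leaving boundary
  terms and the variation of \<open>G\<close>.\<close>

lemma abel_summation_bound:
  fixes G :: "nat \<Rightarrow> complex"
  assumes "cmod w = 1"
  shows "cmod ((1 - w) * (\<Sum>j\<le>m. G j * w ^ j))
    \<le> cmod (G 0) + cmod (G m) + (\<Sum>j<m. cmod (G (Suc j) - G j))"
proof -
  have "(1 - w) * (\<Sum>j\<le>m. G j * w ^ j)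
      = G 0 - G m * w ^ Suc m + (\<Sum>j<m. (G (Suc j) - G j) * w ^ Suc j)"
    by (induction m) (simp_all add: algebra_simps)
  also have "cmod \<dots> \<le> cmod (G 0 - G m * w ^ Suc m) + cmod (\<Sum>j<m. (G (Suc j) - G j) * w ^ Suc j)"
    by (rule norm_triangle_ineq)
  also have "cmod (G 0 - G m * w ^ Suc m) \<le> cmod (G 0) + cmod (G m)"
    using norm_triangle_ineq4[of "G 0" "G m * w ^ Suc m"] assms
    by (simp add: norm_mult norm_power del: power_Suc)
  also have "cmod (\<Sum>j<m. (G (Suc j) - G j) * w ^ Suc j) \<le> (\<Sum>j<m. cmod (G (Suc j) - G j))"
    by (rule sum_norm_le) (use assms in \<open>simp add: norm_mult norm_power del: power_Suc\<close>)
  finally show ?thesis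
    by simp
qed

lemma exp_neg_half_sq_lipschitz:
  fixes a b :: real
  shows "\<bar>exp (- a\<^sup>2 / 2) - exp (- b\<^sup>2 / 2)\<bar> \<le> \<bar>a - b\<bar>"
proof -
  have "norm (exp (- a\<^sup>2 / 2) - exp (- b\<^sup>2 / 2)) \<le> 1 * norm (a - b)"
  proof (rule field_differentiable_bound[of UNIV])
    fix z :: real
    show "((\<lambda>z. exp (- z\<^sup>2 / 2)) has_field_derivative exp (- z\<^sup>2 / 2) * (- z)) (at z within UNIV)"
      by (auto intro!: derivative_eq_intros)
    have "2 * \<bar>z\<bar> \<le> 1 + z\<^sup>2"
      using sum_squares_bound[of 1 "\<bar>z\<bar>"] by simp
    then have "\<bar>z\<bar> \<le> 1 + z\<^sup>2 / 2"
      by simp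
    also have "\<dots> \<le> exp (z\<^sup>2 / 2)"
      by (rule exp_ge_add_one_self)
    finally have "exp (- z\<^sup>2 / 2) * \<bar>z\<bar> \<le> exp (- z\<^sup>2 / 2) * exp (z\<^sup>2 / 2)"
      by (rule mult_left_mono) simp
    also have "\<dots> = 1"
      by (simp add: mult_exp_exp)
    finally show "norm (exp (- z\<^sup>2 / 2) * (- z)) \<le> 1"
      by (simp only: real_norm_def abs_mult abs_exp_cancel abs_minus_cancel)
  qed auto
  then show ?thesis
    by simp
qed

text \<open>The argument is already centred; unfolding yields the expression of the theorem
  literally.\<close>

definition gauss :: "real \<Rightarrow> real \<Rightarrow> real" where
  "gauss \<sigma> u = 1 / (\<sigma> * sqrt (2 * pi)) * exp (- u\<^sup>2 / (2 * \<sigma>\<^sup>2))"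

lemma sqrt_2_pi_ge_1: "1 \<le> sqrt (2 * pi)"
  using pi_ge_two by simp

lemma gauss_bounds:
  assumes "0 < \<sigma>"
  shows "0 \<le> gauss \<sigma> u" "gauss \<sigma> u \<le> 1 / \<sigma>"
    and "\<bar>gauss \<sigma> u - gauss \<sigma> u'\<bar> \<le> \<bar>u - u'\<bar> / \<sigma>\<^sup>2"
proof -
  define w where "w = 1 / (\<sigma> * sqrt (2 * pi))"
  have w: "0 \<le> w" "w \<le> 1 / \<sigma>"
    using assms sqrt_2_pi_ge_1 unfolding w_def by (auto intro!: frac_le)
  have g: "gauss \<sigma> u = w * exp (- (u / \<sigma>)\<^sup>2 / 2)" for u
    by (simp add: gauss_def w_def power_divide)
  show "0 \<le> gauss \<sigma> u"
    using w by (simp add: g)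
  have "exp (- (u / \<sigma>)\<^sup>2 / 2) \<le> 1"
    by simp
  then show "gauss \<sigma> u \<le> 1 / \<sigma>"
    unfolding g using w mult_mono[of w "1 / \<sigma>" "exp (- (u / \<sigma>)\<^sup>2 / 2)" 1] assms by simp
  have "\<bar>gauss \<sigma> u - gauss \<sigma> u'\<bar> = w * \<bar>exp (- (u / \<sigma>)\<^sup>2 / 2) - exp (- (u' / \<sigma>)\<^sup>2 / 2)\<bar>"
    using w by (simp add: g abs_mult flip: right_diff_distrib)
  also have "\<dots> \<le> 1 / \<sigma> * \<bar>u / \<sigma> - u' / \<sigma>\<bar>"
    using w assms by (intro mult_mono exp_neg_half_sq_lipschitz) auto
  also have "\<bar>u / \<sigma> - u' / \<sigma>\<bar> = \<bar>u - u'\<bar> / \<sigma>"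
    using assms by (simp flip: diff_divide_distrib)
  finally show "\<bar>gauss \<sigma> u - gauss \<sigma> u'\<bar> \<le> \<bar>u - u'\<bar> / \<sigma>\<^sup>2"
    by (simp add: power2_eq_square)
qed

text \<open>For \<open>\<tau> \<le> 1\<close> the linear Taylor term dominates the remainder
  \<open>\<tau>\<^sup>2 / 2\<close>.\<close>

lemma norm_one_minus_cis_ge:
  assumes "0 < \<tau>" "\<tau> \<le> 1"
  shows "\<tau> / 2 \<le> cmod (1 - cis \<tau>)"
proof -
  have "\<tau> = cmod (\<i> * \<tau>)"
    using assms by (simp add: norm_mult)
  also have "\<dots> \<le> cmod (cis \<tau> - 1) + cmod (cis \<tau> - 1 - \<i> * \<tau>)"
    using norm_triangle_ineq4[of "cis \<tau> - 1" "cis \<tau> - 1 - \<i> * \<tau>"] by simp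
  also have "cmod (cis \<tau> - 1 - \<i> * \<tau>) \<le> \<tau>\<^sup>2 / 2"
    by (rule cis_approx)
  finally have "\<tau> \<le> cmod (1 - cis \<tau>) + \<tau>\<^sup>2 / 2"
    by (simp add: norm_minus_commute)
  moreover have "\<tau>\<^sup>2 \<le> \<tau>"
    using assms by (simp add: power2_eq_square mult_le_one)
  ultimately show ?thesis
    by linarith
qed

lemma window_eq: "{x::int. \<bar>x - \<mu>\<bar> \<le> r} = {\<lceil>\<mu> - r\<rceil>..\<lfloor>\<mu> + r\<rfloor>}" for \<mu> r :: real
proof -
  have "\<bar>real_of_int x - \<mu>\<bar> \<le> r \<longleftrightarrow> x \<in> {\<lceil>\<mu> - r\<rceil>..\<lfloor>\<mu> + r\<rfloor>}" for x :: int
    by (simp add: ceiling_le_iff le_floor_iff abs_le_iff) linarith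
  then show ?thesis
    by blast
qed

lemma card_window_le:
  fixes \<mu> :: real
  assumes "0 \<le> r"
  shows "real (card {x::int. \<bar>x - \<mu>\<bar> \<le> r}) \<le> 2 * r + 1"
  unfolding window_eq using assms by simp linarith

text \<open>Summation by parts: the window has at most \<open>2 * K * \<sigma>\<close> steps, the
  inner bracket bounds the change of amplitude and quadratic phase per step, and division by
  \<open>1 - cis \<tau>\<close> costs \<open>2 / \<tau>\<close>.\<close>

lemma gauss_exponential_sum_le:
  fixes \<mu> :: real
  assumes \<sigma>: "0 < \<sigma>" and K: "0 < K" and \<tau>: "0 < \<tau>" "\<tau> \<le> 1" and \<kappa>: "0 \<le> \<kappa>"
  shows "cmod (\<Sum>x | \<bar>real_of_int x - \<mu>\<bar> \<le> K * \<sigma>.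
      gauss \<sigma> (x - \<mu>) *\<^sub>R cis (\<tau> * (x - \<mu>) - \<kappa> * (x - \<mu>)\<^sup>2))
    \<le> 2 / \<tau> * (2 / \<sigma> + 2 * K * \<sigma> * (1 / \<sigma>\<^sup>2 + \<kappa> * (2 * K * \<sigma> + 1) / \<sigma>))"
    (is "cmod ?sum \<le> 2 / \<tau> * ?R")
proof -
  define a b where "a = \<lceil>\<mu> - K * \<sigma>\<rceil>" and "b = \<lfloor>\<mu> + K * \<sigma>\<rfloor>"
  have win: "{x::int. \<bar>x - \<mu>\<bar> \<le> K * \<sigma>} = {a..b}"
    unfolding a_def b_def by (rule window_eq)
  have R: "0 \<le> ?R"
    using assms by simp
  show ?thesis
  proof (cases "a \<le> b")
    case False
    then show ?thesis
      using R \<tau> unfolding win by simp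
  next
    case True
    define m where "m = nat (b - a)"
    define h where "h j = real_of_int a + real j - \<mu>" for j :: nat
    \<comment> \<open>The linear phase is left to the powers of \<open>cis \<tau>\<close>; the
      constant and quadratic phases join the slowly varying factor.\<close>
    define G where "G j = gauss \<sigma> (h j) *\<^sub>R cis (\<tau> * (a - \<mu>) - \<kappa> * (h j)\<^sup>2)" for j
    have h: "\<bar>h j\<bar> \<le> K * \<sigma>" if "j \<le> m" for j
    proof -
      have "a + int j \<in> {x::int. \<bar>x - \<mu>\<bar> \<le> K * \<sigma>}"
        unfolding win using that True by (simp add: m_def)
      then show ?thesis
        by (simp add: h_def)
    qed
    have m: "real m \<le> 2 * K * \<sigma>"
      using h[of 0] h[of m] by (simp add: h_def abs_le_iff)
    have "?sum = (\<Sum>x\<in>{a..b}. gauss \<sigma> (x - \<mu>) *\<^sub>R cis (\<tau> * (x - \<mu>) - \<kappa> * (x - \<mu>)\<^sup>2))"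
      unfolding win ..
    also have "\<dots> = (\<Sum>j\<le>m. G j * cis \<tau> ^ j)"
    proof (rule sum.reindex_bij_witness[of _ "\<lambda>j. a + int j" "\<lambda>x. nat (x - a)"])
      fix x assume x: "x \<in> {a..b}"
      then have h_x: "h (nat (x - a)) = x - \<mu>"
        by (simp add: h_def)
      have "cis (\<tau> * (a - \<mu>) - \<kappa> * (x - \<mu>)\<^sup>2) * cis (real (nat (x - a)) * \<tau>)
          = cis (\<tau> * (x - \<mu>) - \<kappa> * (x - \<mu>)\<^sup>2)"
        using x by (simp add: cis_mult algebra_simps)
      then show "G (nat (x - a)) * cis \<tau> ^ nat (x - a)
          = gauss \<sigma> (x - \<mu>) *\<^sub>R cis (\<tau> * (x - \<mu>) - \<kappa> * (x - \<mu>)\<^sup>2)"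
        unfolding G_def h_x Complex.DeMoivre by (simp only: mult_scaleR_left)
    qed (use True in \<open>auto simp: m_def\<close>)
    finally have sum_eq: "?sum = (\<Sum>j\<le>m. G j * cis \<tau> ^ j)" .
    have G: "cmod (G j) \<le> 1 / \<sigma>" for j
      using gauss_bounds(1,2)[OF \<sigma>, of "h j"] by (simp add: G_def)
    have dG: "cmod (G (Suc j) - G j) \<le> 1 / \<sigma>\<^sup>2 + \<kappa> * (2 * K * \<sigma> + 1) / \<sigma>" if "j < m" for j
    proof -
      let ?z = "\<lambda>j. cis (\<tau> * (a - \<mu>) - \<kappa> * (h j)\<^sup>2)"
      have h_Suc: "h (Suc j) = h j + 1"
        by (simp add: h_def)
      have "G (Suc j) - G j = (gauss \<sigma> (h (Suc j)) - gauss \<sigma> (h j)) *\<^sub>R ?z (Suc j)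
          + gauss \<sigma> (h j) *\<^sub>R (?z (Suc j) - ?z j)"
        by (simp add: G_def algebra_simps)
      also have "cmod \<dots> \<le> cmod ((gauss \<sigma> (h (Suc j)) - gauss \<sigma> (h j)) *\<^sub>R ?z (Suc j))
          + cmod (gauss \<sigma> (h j) *\<^sub>R (?z (Suc j) - ?z j))"
        by (rule norm_triangle_ineq)
      also have "cmod ((gauss \<sigma> (h (Suc j)) - gauss \<sigma> (h j)) *\<^sub>R ?z (Suc j)) \<le> 1 / \<sigma>\<^sup>2"
        using gauss_bounds(3)[OF \<sigma>, of "h (Suc j)" "h j"] by (simp add: h_Suc)
      also have "cmod (gauss \<sigma> (h j) *\<^sub>R (?z (Suc j) - ?z j)) \<le> 1 / \<sigma> * (\<kappa> * (2 * K * \<sigma> + 1))"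
      proof -
        have "cmod (?z (Suc j) - ?z j) \<le> \<bar>(\<tau> * (a - \<mu>) - \<kappa> * (h (Suc j))\<^sup>2) - (\<tau> * (a - \<mu>) - \<kappa> * (h j)\<^sup>2)\<bar>"
          by (rule norm_cis_diff_le)
        also have "\<dots> = \<bar>\<kappa> * (2 * h j + 1)\<bar>"
          unfolding h_Suc by (simp add: power2_eq_square algebra_simps abs_minus_commute)
        also have "\<dots> \<le> \<kappa> * (2 * K * \<sigma> + 1)"
          unfolding abs_mult using \<kappa> h[of j] that by (intro mult_mono) auto
        finally show ?thesis
          unfolding norm_scaleR using gauss_bounds(1,2)[OF \<sigma>, of "h j"] \<sigma>
          by (intro mult_mono) auto
      qed
      finally show ?thesis
        by simp
    qed
    have "\<tau> / 2 * cmod ?sum \<le> cmod (1 - cis \<tau>) * cmod ?sum"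
      by (rule mult_right_mono[OF norm_one_minus_cis_ge[OF \<tau>]]) simp
    also have "\<dots> = cmod ((1 - cis \<tau>) * (\<Sum>j\<le>m. G j * cis \<tau> ^ j))"
      by (simp only: norm_mult sum_eq)
    also have "\<dots> \<le> cmod (G 0) + cmod (G m) + (\<Sum>j<m. cmod (G (Suc j) - G j))"
      by (rule abel_summation_bound) simp
    also have "\<dots> \<le> 1 / \<sigma> + 1 / \<sigma> + (\<Sum>j<m. 1 / \<sigma>\<^sup>2 + \<kappa> * (2 * K * \<sigma> + 1) / \<sigma>)"
      by (intro add_mono sum_mono G dG) auto
    also have "\<dots> = 2 / \<sigma> + real m * (1 / \<sigma>\<^sup>2 + \<kappa> * (2 * K * \<sigma> + 1) / \<sigma>)"
      by simp
    also have "\<dots> \<le> ?R"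
      by (intro add_left_mono mult_right_mono m) (use assms in simp)
    finally show ?thesis
      using \<tau> by (simp add: field_simps)
  qed
qed

section \<open>Arithmetic progressions modulo n\<close>

context bernoulli_subset
begin

lemma pmf_random_subset:
  assumes "S \<subseteq> {..<n}"
  shows "pmf (random_subset_pmf n p) S = wt {..<n} S"
proof -
  have "pmf (random_subset_pmf n p) (Collect (\<lambda>i. i \<in> S))
      = pmf (Pi_pmf {0..<n} False (\<lambda>_. bernoulli_pmf p)) (\<lambda>i. i \<in> S)"
    unfolding random_subset_pmf_def by (rule pmf_map_inj') (auto simp: inj_on_def)
  also have "\<dots> = (\<Prod>i\<in>{0..<n}. pmf (bernoulli_pmf p) (i \<in> S))"
    using assms by (intro pmf_Pi') auto
  also have "\<dots> = wt {..<n} S"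
    unfolding wt_def using p_pos p_less_1 by (intro prod.cong) auto
  finally show ?thesis
    by simp
qed

lemma set_pmf_random_subset: "set_pmf (random_subset_pmf n p) \<subseteq> Pow {..<n}"
  using set_Pi_pmf_subset[of "{0..<n}" False "\<lambda>_. bernoulli_pmf p"]
  by (auto simp: random_subset_pmf_def subset_iff)

lemma expectation_eq_ev:
  fixes F :: "nat set \<Rightarrow> 'a::{banach, second_countable_topology}"
  shows "measure_pmf.expectation (random_subset_pmf n p) F = ev F"
proof -
  have "measure_pmf.expectation (random_subset_pmf n p) F
      = (\<Sum>S\<in>Pow {..<n}. pmf (random_subset_pmf n p) S *\<^sub>R F S)"
    using set_pmf_random_subset by (intro integral_measure_pmf) auto
  then show ?thesis
    by (simp add: ev_def pmf_random_subset)
qed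

lemma prob_eq_ev: "measure_pmf.prob (random_subset_pmf n p) {S. Q S} = ev (\<lambda>S. of_bool (Q S))"
proof -
  have "measure_pmf.prob (random_subset_pmf n p) {S. Q S}
      = measure_pmf.expectation (random_subset_pmf n p) (indicator {S. Q S})"
    by simp
  also have "\<dots> = ev (\<lambda>S. of_bool (Q S))"
    unfolding expectation_eq_ev by (rule ev_cong) (simp add: indicator_def)
  finally show ?thesis .
qed

definition M :: "nat set \<Rightarrow> real" where
  "M S = (\<Sum>i<n. y i S)"

text \<open>The second elementary symmetric polynomial in the \<open>y i\<close>.\<close>

definition e2 :: "nat set \<Rightarrow> real" where
  "e2 S = (\<Sum>V | V \<subseteq> {..<n} \<and> card V = 2. mon V S)"

lemma mon_singleton [simp]: "mon {i} = y i"
  by (rule ext) (simp add: mon_def)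

lemma M_eq_card: "S \<subseteq> {..<n} \<Longrightarrow> M S = card S - p * n"
  by (simp add: M_def y_def sum_subtractf Int_absorb1 Int_absorb2)

lemma y_sq: "(y i S)\<^sup>2 = (1 - 2 * p) * y i S + v"
  by (auto simp: y_def v_def power2_eq_square algebra_simps)

lemma sum_pairs_eq:
  assumes "finite A"
  shows "2 * (\<Sum>V | V \<subseteq> A \<and> card V = 2. mon V S) = (\<Sum>i\<in>A. y i S)\<^sup>2 - (\<Sum>i\<in>A. (y i S)\<^sup>2)"
  using assms
proof induction
  case empty
  then show ?case
    by (auto intro!: sum.neutral)
next
  case (insert a A)
  have split: "{V. V \<subseteq> insert a A \<and> card V = 2} = {V. V \<subseteq> A \<and> card V = 2} \<union> (\<lambda>b. {a, b}) ` A"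
  proof (intro equalityI subsetI)
    fix V assume "V \<in> {V. V \<subseteq> insert a A \<and> card V = 2}"
    then obtain b c where V: "V = {b, c}" "b \<noteq> c" "{b, c} \<subseteq> insert a A"
      by (auto simp: card_2_iff)
    then show "V \<in> {V. V \<subseteq> A \<and> card V = 2} \<union> (\<lambda>b. {a, b}) ` A"
      using insert.hyps by (cases "b = a"; cases "c = a") (auto simp: insert_commute)
  qed (use insert.hyps in \<open>auto simp: card_2_iff\<close>)
  have "(\<Sum>V | V \<subseteq> insert a A \<and> card V = 2. mon V S)
      = (\<Sum>V | V \<subseteq> A \<and> card V = 2. mon V S) + (\<Sum>V\<in>(\<lambda>b. {a, b}) ` A. mon V S)"
    unfolding split by (rule sum.union_disjoint) (use insert.hyps in auto)
  also have "(\<Sum>V\<in>(\<lambda>b. {a, b}) ` A. mon V S) = (\<Sum>b\<in>A. y a S * y b S)"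
  proof (rule sum.reindex_cong[of "\<lambda>b. {a, b}"])
    fix b assume "b \<in> A"
    then have "a \<noteq> b"
      using insert.hyps by auto
    then show "mon {a, b} S = y a S * y b S"
      by (simp add: mon_def)
  qed (auto simp: inj_on_def doubleton_eq_iff)
  finally show ?case
    using insert by (simp add: power2_sum sum_distrib_left algebra_simps)
qed

text \<open>Newton's identity, where the sum of squares is affine in \<open>M\<close> because each
  \<open>y i\<close> takes only two values. This makes the quadratic part of kAP a function of
  \<open>M\<close>.\<close>

lemma two_e2: "2 * e2 S = (M S)\<^sup>2 - (1 - 2 * p) * M S - n * v"
  using sum_pairs_eq[of "{..<n}" S]
  by (simp add: e2_def M_def y_sq sum.distrib sum_distrib_left)

lemma ev_M: "ev M = 0"
proof -
  have "ev (y i) = 0" if "i < n" for i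
    using ev_mon_eq_0[of "{i}"] that by simp
  then show ?thesis
    unfolding M_def[abs_def] by (simp add: ev_sum)
qed

lemma ev_e2: "ev e2 = 0"
  unfolding e2_def[abs_def] ev_sum by (rule sum.neutral) (auto intro!: ev_mon_eq_0)

lemma ev_M_sq: "ev (\<lambda>S. (M S)\<^sup>2) = n * v"
proof -
  have "(\<lambda>S. (M S)\<^sup>2) = (\<lambda>S. 2 * e2 S + (1 - 2 * p) * M S + n * v)"
    using two_e2 by (simp add: algebra_simps)
  then show ?thesis
    by (simp add: ev_add ev_mult_left ev_M ev_e2)
qed

lemma ev_e2_sq_le: "ev (\<lambda>S. (e2 S)\<^sup>2) \<le> n\<^sup>2"
proof -
  let ?I = "{V. V \<subseteq> {..<n} \<and> card V = 2}"
  have "ev (\<lambda>S. (\<Sum>V\<in>?I. 1 * mon V S)\<^sup>2) \<le> 1 * real (card ?I)"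
  proof (rule ev_sum_mon_sq_le)
    fix e assume "e \<in> ?I"
    then have "{f \<in> ?I. f = e} = {e}"
      by auto
    then show "real (card {f \<in> ?I. f = e}) \<le> 1"
      by simp
  qed auto
  also have "card ?I = n choose 2"
    using n_subsets[of "{..<n}" 2] by simp
  also have "1 * real (n choose 2) \<le> real (n\<^sup>2)"
    by (simp add: choose_two power2_eq_square del: of_nat_mult of_nat_power)
      (metis div_le_dividend diff_le_self mult_le_mono2 order_trans)
  finally show ?thesis
    by (simp add: e2_def)
qed

end

section \<open>Progressions modulo n and their pairs of points\<close>

locale cyclic_ap = bernoulli_subset n p for n :: nat and p :: real +
  fixes k :: nat
  assumes k_ge_3: "3 \<le> k" and coprime_n: "coprime n (fact (k - 1))" and n_pos: "0 < n"
begin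

definition pt :: "nat \<Rightarrow> nat \<Rightarrow> nat \<Rightarrow> nat" where
  "pt a d s = (a + s * d) mod n"

definition P :: "(nat \<times> nat) set" where
  "P = {..<n} \<times> {1..n div 2}"

text \<open>Here \<open>q\<close> is a pair of start and difference, and \<open>T\<close> a set of
  positions in the progression.\<close>

definition img :: "nat set \<Rightarrow> nat \<times> nat \<Rightarrow> nat set" where
  "img T q = pt (fst q) (snd q) ` T"

text \<open>As \<open>k\<close> is at least 3, 2 divides \<open>fact (k - 1)\<close>.\<close>

lemma odd_n: "odd n"
proof
  assume "even n"
  moreover have "(2::nat) dvd fact (k - 1)"
    using k_ge_3 by (intro dvd_fact) auto
  ultimately show False
    using coprime_n by (metis coprime_common_divisor_nat odd_one even_numeral dvd_refl numeral_eq_one_iff semiring_norm(85))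
qed

lemma coprime_small:
  assumes "0 < r" "r < k"
  shows "coprime n r"
proof -
  have "r dvd fact (k - 1)"
    using assms by (intro dvd_fact) auto
  then show ?thesis
    using coprime_n coprime_divisors[of n n r "fact (k - 1)"] by auto
qed

lemma dvd_cancel:
  fixes x :: int
  assumes "s < t" "t < k" "int n dvd (int t - int s) * x"
  shows "int n dvd x"
proof -
  have "coprime n (t - s)"
    by (rule coprime_small) (use assms in auto)
  then have "coprime (int n) (int t - int s)"
    using assms(1) by (metis coprime_int_iff less_imp_le of_nat_diff)
  then show ?thesis
    using assms(3) coprime_dvd_mult_right_iff by blast
qed

text \<open>Stated over the integers so that two congruences can be subtracted.\<close>

lemma pt_eq_iff: "pt a d s = pt a' d' s' \<longleftrightarrow> int n dvd (int a + int s * int d) - (int a' + int s' * int d')"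
proof -
  have "pt a d s = pt a' d' s' \<longleftrightarrow> int (pt a d s) = int (pt a' d' s')"
    by simp
  also have "\<dots> \<longleftrightarrow> (int a + int s * int d) mod int n = (int a' + int s' * int d') mod int n"
    by (simp add: pt_def zmod_int)
  finally show ?thesis
    by (simp add: mod_eq_dvd_iff)
qed

lemma pt_less: "pt a d s < n"
  using n_pos by (simp add: pt_def)

lemma pt_neq:
  assumes "(a, d) \<in> P" "s < t" "t < k"
  shows "pt a d t \<noteq> pt a d s"
proof
  assume "pt a d t = pt a d s"
  then have "int n dvd (int t - int s) * int d"
    unfolding pt_eq_iff by (simp add: algebra_simps)
  then have "int n dvd int d"
    by (rule dvd_cancel[OF assms(2,3)])
  then have "n \<le> d"
    using assms(1) by (auto simp: P_def dest: dvd_imp_le)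
  then show False
    using assms(1) n_pos by (auto simp: P_def)
qed

lemma inj_on_pt:
  assumes "q \<in> P"
  shows "inj_on (pt (fst q) (snd q)) {..<k}"
proof (rule inj_onI, rule ccontr)
  fix s t assume "s \<in> {..<k}" "t \<in> {..<k}" "pt (fst q) (snd q) s = pt (fst q) (snd q) t" "s \<noteq> t"
  then show False
    using pt_neq[of "fst q" "snd q" s t] pt_neq[of "fst q" "snd q" t s] assms
    by (cases s t rule: linorder_cases) auto
qed

text \<open>Oddness of \<open>n\<close> is what makes the exchange of two points impossible: it would force
  \<open>n\<close> to divide \<open>d + d'\<close>, and \<open>0 < d + d' < n\<close>.\<close>

lemma inj_on_img_less:
  assumes "s < t" "t < k"
  shows "inj_on (img {s, t}) P"
proof (rule inj_onI)
  fix q q' assume q: "q \<in> P" "q' \<in> P" and eq: "img {s, t} q = img {s, t} q'"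
  obtain a d a' d' where [simp]: "q = (a, d)" "q' = (a', d')"
    by (cases q; cases q')
  have bounds: "a < n" "a' < n" "0 < d" "0 < d'" "d + d' < n"
    using q odd_n by (auto simp: P_def elim!: oddE)
  consider "pt a d s = pt a' d' s" "pt a d t = pt a' d' t"
    | "pt a d s = pt a' d' t" "pt a d t = pt a' d' s"
    using eq by (auto simp: img_def doubleton_eq_iff)
  then show "q = q'"
  proof cases
    case 1
    then have "int n dvd ((int a + int t * int d) - (int a' + int t * int d'))
        - ((int a + int s * int d) - (int a' + int s * int d'))"
      unfolding pt_eq_iff by (simp only: dvd_diff)
    then have "int n dvd (int t - int s) * (int d - int d')"
      by (simp add: algebra_simps)
    then have "int n dvd int d - int d'"
      by (rule dvd_cancel[OF assms])
    then have "d = d'"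
      using bounds zdvd_imp_le[of "int n" "int d - int d'"] zdvd_imp_le[of "int n" "int d' - int d"]
      by (cases d d' rule: linorder_cases) (auto simp: dvd_diff_commute)
    then have "int n dvd int a - int a'"
      using 1 unfolding pt_eq_iff by simp
    then have "a = a'"
      using bounds zdvd_imp_le[of "int n" "int a - int a'"] zdvd_imp_le[of "int n" "int a' - int a"]
      by (cases a a' rule: linorder_cases) (auto simp: dvd_diff_commute)
    then show ?thesis
      using \<open>d = d'\<close> by simp
  next
    case 2
    then have "int n dvd ((int a + int t * int d) - (int a' + int s * int d'))
        - ((int a + int s * int d) - (int a' + int t * int d'))"
      unfolding pt_eq_iff by (simp only: dvd_diff)
    then have "int n dvd (int t - int s) * (int d + int d')"
      by (simp add: algebra_simps)
    then have "int n dvd int d + int d'"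
      by (rule dvd_cancel[OF assms])
    then show ?thesis
      using bounds zdvd_imp_le[of "int n" "int d + int d'"] by auto
  qed
qed

lemma inj_on_img:
  assumes "T \<subseteq> {..<k}" "card T = 2"
  shows "inj_on (img T) P"
proof -
  obtain s t where "T = {s, t}" "s \<noteq> t"
    using assms(2) by (auto simp: card_2_iff)
  then show ?thesis
    using inj_on_img_less[of s t] inj_on_img_less[of t s] assms(1)
    by (cases s t rule: linorder_cases) (auto simp: insert_commute)
qed

lemma finite_P: "finite P"
  by (simp add: P_def)

lemma card_P: "card P = n * (n div 2)"
  by (simp add: P_def)

lemma card_img: "q \<in> P \<Longrightarrow> T \<subseteq> {..<k} \<Longrightarrow> card (img T q) = card T"
  unfolding img_def by (rule card_image) (rule inj_on_subset[OF inj_on_pt])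

lemma img_subset: "img T q \<subseteq> {..<n}"
  by (auto simp: img_def pt_less)

text \<open>For a fixed pair of positions, progressions correspond bijectively to pairs of residues:
  the map is injective, and for odd \<open>n\<close> both sides have \<open>n * (n div 2)\<close>
  elements.\<close>

lemma sum_mon_pairs:
  assumes "T \<subseteq> {..<k}" "card T = 2"
  shows "(\<Sum>q\<in>P. mon (img T q) S) = e2 S"
proof -
  let ?I = "{V. V \<subseteq> {..<n} \<and> card V = 2}"
  have "img T ` P = ?I"
  proof (rule card_subset_eq)
    show "img T ` P \<subseteq> ?I"
      using img_subset card_img assms by auto
    have "card (img T ` P) = n * (n div 2)"
      by (simp add: card_image inj_on_img assms card_P)
    also have "\<dots> = n choose 2"
      using odd_n by (auto elim!: oddE simp: choose_two)
    also have "\<dots> = card ?I"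
      using n_subsets[of "{..<n}" 2] by simp
    finally show "card (img T ` P) = card ?I" .
  qed auto
  then show ?thesis
    unfolding e2_def using sum.reindex[OF inj_on_img[OF assms], of "\<lambda>V. mon V S"] by simp
qed

text \<open>For a fixed position and difference, moving the start permutes the residues.\<close>

lemma sum_mon_singletons:
  assumes "T \<subseteq> {..<k}" "card T = 1"
  shows "(\<Sum>q\<in>P. mon (img T q) S) = (n div 2) * M S"
proof -
  obtain s where T: "T = {s}"
    using assms(2) by (auto simp: card_1_singleton_iff)
  have shift: "(\<Sum>a<n. y (pt a d s) S) = M S" for d
  proof -
    have "inj_on (\<lambda>a. pt a d s) {..<n}"
    proof (rule inj_onI)
      fix a a' assume a: "a \<in> {..<n}" "a' \<in> {..<n}" and "pt a d s = pt a' d s"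
      then have "int n dvd int a - int a'"
        unfolding pt_eq_iff by simp
      then show "a = a'"
        using a zdvd_imp_le[of "int n" "int a - int a'"] zdvd_imp_le[of "int n" "int a' - int a"]
        by (cases a a' rule: linorder_cases) (auto simp: dvd_diff_commute)
    qed
    moreover from this have "(\<lambda>a. pt a d s) ` {..<n} = {..<n}"
      by (rule endo_inj_surj[rotated 2]) (auto simp: pt_less)
    ultimately show ?thesis
      unfolding M_def using sum.reindex[of "\<lambda>a. pt a d s" "{..<n}" "\<lambda>i. y i S"] by simp
  qed
  have "(\<Sum>q\<in>P. mon (img T q) S) = (\<Sum>a<n. \<Sum>d=1..n div 2. y (pt a d s) S)"
    unfolding P_def sum.cartesian_product by (simp add: T img_def mon_def case_prod_beta)
  also have "\<dots> = (\<Sum>d=1..n div 2. \<Sum>a<n. y (pt a d s) S)"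
    by (rule sum.swap)
  finally show ?thesis
    by (simp add: shift)
qed

section \<open>Chaos expansion of the count\<close>

definition I :: "((nat \<times> nat) \<times> nat set) set" where
  "I = P \<times> {T. T \<subseteq> {..<k} \<and> 3 \<le> card T}"

definition U :: "(nat \<times> nat) \<times> nat set \<Rightarrow> nat set" where
  "U e = img (snd e) (fst e)"

text \<open>In the expansion of the product of the \<open>y + p\<close> along a progression, each
  position outside \<open>snd e\<close> contributes a factor \<open>p\<close>.\<close>

definition c :: "(nat \<times> nat) \<times> nat set \<Rightarrow> real" where
  "c e = p ^ (k - card (snd e))"

definition L :: nat where
  "L = 2 ^ k * (k * k)"

text \<open>There are \<open>2 ^ k\<close> choices for the position set and \<open>k * k\<close> for
  the positions of \<open>i\<close> and \<open>j\<close>; then \<open>inj_on_img\<close> leaves at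
  most one progression.\<close>

lemma pair_degree_le:
  assumes "i \<noteq> j"
  shows "card {e \<in> I. i \<in> U e \<and> j \<in> U e} \<le> L"
proof -
  let ?Z = "\<lambda>T s t. {e. snd e = T \<and> fst e \<in> P \<and> s \<noteq> t \<and> img {s, t} (fst e) = {i, j}}"
  let ?B = "\<Union>T\<in>Pow {..<k}. \<Union>s\<in>{..<k}. \<Union>t\<in>{..<k}. ?Z T s t"
  have Z: "finite (?Z T s t) \<and> card (?Z T s t) \<le> 1" if "s < k" "t < k" for T s t
  proof -
    have "?Z T s t \<subseteq> P \<times> {T}"
      by auto
    then have fin: "finite (?Z T s t)"
      by (rule finite_subset) (simp add: finite_P)
    moreover have "e = e'" if "e \<in> ?Z T s t" "e' \<in> ?Z T s t" for e e'
      using that inj_on_img[of "{s, t}"] \<open>s < k\<close> \<open>t < k\<close>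
      by (auto simp: inj_on_def prod_eq_iff)
    ultimately show ?thesis
      by (auto simp: card_le_Suc0_iff_eq)
  qed
  have "{e \<in> I. i \<in> U e \<and> j \<in> U e} \<subseteq> ?B"
  proof
    fix e assume e: "e \<in> {e \<in> I. i \<in> U e \<and> j \<in> U e}"
    obtain q T where [simp]: "e = (q, T)"
      by (cases e)
    from e obtain s t where "s \<in> T" "t \<in> T" "i = pt (fst q) (snd q) s" "j = pt (fst q) (snd q) t"
      by (auto simp: U_def img_def)
    moreover have "s \<noteq> t" "q \<in> P" "T \<subseteq> {..<k}"
      using e assms calculation by (auto simp: I_def)
    ultimately have "s < k" "t < k" "T \<in> Pow {..<k}" "e \<in> ?Z T s t"
      by (auto simp: img_def)
    then show "e \<in> ?B"
      by blast
  qed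
  moreover have "finite ?B"
    by (intro finite_UN_I Z[THEN conjunct1]) auto
  ultimately have "card {e \<in> I. i \<in> U e \<and> j \<in> U e} \<le> card ?B"
    by (rule card_mono[rotated])
  also have "\<dots> \<le> card (Pow {..<k}) * (card {..<k} * (card {..<k} * 1))"
    by (intro card_UN_le_mult Z[THEN conjunct2]) auto
  finally show ?thesis
    by (simp add: L_def card_Pow)
qed

sublocale edge_family n p I U c k L
proof unfold_locales
  show "finite I"
    by (simp add: I_def finite_P)
  show "1 \<le> L"
    using k_ge_3 by (simp add: L_def)
  fix e assume "e \<in> I"
  then have e: "fst e \<in> P" "snd e \<subseteq> {..<k}" "3 \<le> card (snd e)"
    by (auto simp: I_def)
  show "U e \<subseteq> {..<n}"
    unfolding U_def by (rule img_subset)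
  have "card (snd e) \<le> card {..<k}"
    using e by (intro card_mono) auto
  then show "3 \<le> card (U e)" "card (U e) \<le> k"
    using e by (simp_all add: U_def card_img)
  show "\<bar>c e\<bar> \<le> 1"
    using p_pos p_less_1 by (simp add: c_def power_le_one)
qed (rule pair_degree_le)

text \<open>Half the coefficient of \<open>e2\<close>, hence the coefficient of
  \<open>(M S)\<^sup>2\<close> after \<open>two_e2\<close>.\<close>

definition B :: real where
  "B = (k choose 2) * p ^ (k - 2) / 2"

definition A0 :: real where
  "A0 = k * (n div 2) * p ^ (k - 1)"

definition \<mu> :: real where
  "\<mu> = n * (n div 2) * p ^ k"

text \<open>Write each indicator as \<open>y + p\<close>, expand over sets \<open>T\<close> of
  positions and group by \<open>card T\<close> equal to 0, 1, 2 or at least 3.\<close>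

lemma kAP_expansion: "real (kAP k n S) = \<mu> + A0 * M S + 2 * B * e2 S + Y S"
proof -
  define F where "F T = (\<Sum>q\<in>P. mon (img T q) S) * p ^ (k - card T)" for T
  have "real (kAP k n S) = (\<Sum>a<n. \<Sum>d=1..n div 2. \<Prod>s<k. y (pt a d s) S + p)"
    unfolding kAP_def by (simp add: pt_def y_def indicator_def atLeast0LessThan of_bool_def
        if_distrib[of real] cong: if_cong)
  also have "\<dots> = (\<Sum>q\<in>P. \<Prod>s<k. y (pt (fst q) (snd q) s) S + p)"
    unfolding P_def sum.cartesian_product by (simp add: case_prod_beta)
  also have "\<dots> = (\<Sum>q\<in>P. \<Sum>T\<in>Pow {..<k}. mon (img T q) S * p ^ (k - card T))"
  proof (rule sum.cong)
    fix q assume q: "q \<in> P"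
    have "(\<Prod>s\<in>T. y (pt (fst q) (snd q) s) S) = mon (img T q) S" if "T \<subseteq> {..<k}" for T
      unfolding mon_def img_def
      by (subst prod.reindex[OF inj_on_subset[OF inj_on_pt[OF q] that]]) simp
    moreover have "card ({..<k} - T) = k - card T" if "T \<subseteq> {..<k}" for T
      using that by (simp add: card_Diff_subset finite_subset)
    ultimately show "(\<Prod>s<k. y (pt (fst q) (snd q) s) S + p) = (\<Sum>T\<in>Pow {..<k}. mon (img T q) S * p ^ (k - card T))"
      by (subst prod_add) auto
  qed simp
  also have "\<dots> = (\<Sum>T\<in>Pow {..<k}. F T)"
    unfolding F_def sum_distrib_right by (rule sum.swap)
  also have "Pow {..<k} = {T. T \<subseteq> {..<k} \<and> card T = 0} \<union> ({T. T \<subseteq> {..<k} \<and> card T = 1}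
      \<union> ({T. T \<subseteq> {..<k} \<and> card T = 2} \<union> {T. T \<subseteq> {..<k} \<and> 3 \<le> card T}))"
    by auto
  also have "sum F \<dots> = sum F {T. T \<subseteq> {..<k} \<and> card T = 0} + (sum F {T. T \<subseteq> {..<k} \<and> card T = 1}
      + (sum F {T. T \<subseteq> {..<k} \<and> card T = 2} + sum F {T. T \<subseteq> {..<k} \<and> 3 \<le> card T}))"
    by (subst sum.union_disjoint; (subst sum.union_disjoint)?; (subst sum.union_disjoint)?; auto)
  also have "sum F {T. T \<subseteq> {..<k} \<and> card T = 0} = \<mu>"
  proof -
    have "{T. T \<subseteq> {..<k} \<and> card T = 0} = {{}}"
      by (auto simp: card_eq_0_iff dest: finite_subset)
    then show ?thesis
      by (simp add: F_def img_def mon_def card_P \<mu>_def)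
  qed
  also have "sum F {T. T \<subseteq> {..<k} \<and> card T = 1} = A0 * M S"
  proof -
    have "sum F {T. T \<subseteq> {..<k} \<and> card T = 1} = (\<Sum>T | T \<subseteq> {..<k} \<and> card T = 1. (n div 2) * M S * p ^ (k - 1))"
      by (rule sum.cong) (auto simp: F_def sum_mon_singletons)
    then show ?thesis
      using n_subsets[of "{..<k}" 1] by (simp add: A0_def)
  qed
  also have "sum F {T. T \<subseteq> {..<k} \<and> card T = 2} = 2 * B * e2 S"
  proof -
    have "sum F {T. T \<subseteq> {..<k} \<and> card T = 2} = (\<Sum>T | T \<subseteq> {..<k} \<and> card T = 2. e2 S * p ^ (k - 2))"
      by (rule sum.cong) (auto simp: F_def sum_mon_pairs)
    then show ?thesis
      using n_subsets[of "{..<k}" 2] by (simp add: B_def)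
  qed
  also have "sum F {T. T \<subseteq> {..<k} \<and> 3 \<le> card T} = Y S"
  proof -
    have "Y S = (\<Sum>q\<in>P. \<Sum>T | T \<subseteq> {..<k} \<and> 3 \<le> card T. p ^ (k - card T) * mon (img T q) S)"
      unfolding Y_def unfolding I_def c_def U_def by (simp add: sum.cartesian_product case_prod_beta)
    then show ?thesis
      unfolding F_def sum_distrib_right by (subst sum.swap) (simp add: mult.commute)
  qed
  finally show ?thesis
    by simp
qed

end

section \<open>Failure of the local limit theorem\<close>

lemma sum3_sq_le: "(a + b + c)\<^sup>2 \<le> 3 * (a\<^sup>2 + b\<^sup>2 + c\<^sup>2)" for a b c :: real
  using sum_squares_bound[of a b] sum_squares_bound[of a c] sum_squares_bound[of b c]
  by (simp add: power2_eq_square algebra_simps)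

lemma sum2_sq_le: "(a + b)\<^sup>2 \<le> 2 * a\<^sup>2 + 2 * b\<^sup>2" for a b :: real
  using sum_squares_bound[of a b] by (simp add: power2_eq_square algebra_simps)

context cyclic_ap
begin

section \<open>Constants and second moments\<close>

abbreviation X :: "nat set \<Rightarrow> real" where
  "X S \<equiv> real (kAP k n S)"

text \<open>Corrects \<open>A0\<close> by the linear term that \<open>two_e2\<close>
  contributes.\<close>

definition A :: real where
  "A = A0 - B * (1 - 2 * p)"

definition r :: "nat set \<Rightarrow> real" where
  "r S = X S - \<mu> - A * M S"

text \<open>A lower bound for \<open>A / n\<close>, see \<open>A_bounds\<close>. The constants from
  here to \<open>threshold\<close> depend on \<open>p\<close> and \<open>k\<close> only.\<close>

definition slope :: real where
  "slope = k * p ^ (k - 1) / 4"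

text \<open>Bounds \<open>\<tau> * n\<close>, the argument at which \<open>chf\<close> is evaluated;
  \<open>c0\<close> is then the value that \<open>chf_lower_bound\<close> yields.\<close>

definition T0 :: real where
  "T0 = max 1 (2 * pi / slope)"

definition c0 :: real where
  "c0 = exp (- (k\<^sup>2 * L\<^sup>2 * T0\<^sup>2)) / 2"

definition C1 :: real where
  "C1 = 3 * (2 * k ^ 4 + L\<^sup>2)"

definition C\<^sub>\<kappa> :: real where
  "C\<^sub>\<kappa> = 2 * pi / slope * k\<^sup>2 / slope\<^sup>2"

definition C3 :: real where
  "C3 = C\<^sub>\<kappa> * (k * (1 + C1) + C1)"

definition C4 :: real where
  "C4 = 2 * k\<^sup>2 + 2 * C1"

definition C5 :: real where
  "C5 = slope\<^sup>2 * v / 4"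

text \<open>Half-width of the window in standard deviations, chosen so that the Chebyshev tail
  \<open>1 / K\<^sup>2\<close> is \<open>c0 / 4\<close>.\<close>

definition K :: real where
  "K = 2 / sqrt c0"

definition C7 :: real where
  "C7 = k * ((2 + 2 * K) / sqrt C5 + 2 * K * C\<^sub>\<kappa> * (2 * K * sqrt C4 + 1))"

text \<open>Chosen so that the total error \<open>3 * K * deviation\<close> over the window is
  \<open>c0 / 4\<close>.\<close>

definition deviation :: real where
  "deviation = c0 / (12 * K)"

text \<open>A sum of nonnegative lower bounds for \<open>n\<close>, so that one hypothesis yields
  them all.\<close>

definition threshold :: real where
  "threshold = 12 * k / p ^ (k - 1) + 4 * C1 / (slope\<^sup>2 * v) + 2 * pi / slope + 1 / C5
    + (2 * (exp (k\<^sup>2 * L\<^sup>2 * T0\<^sup>2) * (C * T0 ^ 3)))\<^sup>2 + (8 * (C3 + C7) / c0)\<^sup>2"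

text \<open>This form serves the second moment of \<open>r\<close>, the next one the phase
  computation.\<close>

lemma r_eq_chaos: "r S = B * (1 - 2 * p) * M S + 2 * B * e2 S + Y S"
  unfolding r_def A_def kAP_expansion by (simp add: algebra_simps)

lemma r_eq_quadratic: "r S = B * (M S)\<^sup>2 - B * n * v + Y S"
proof -
  have "2 * B * e2 S = B * ((M S)\<^sup>2 - (1 - 2 * p) * M S - n * v)"
    using two_e2[of S] by (simp add: mult.assoc mult.left_commute)
  then show ?thesis
    unfolding r_eq_chaos by (simp add: algebra_simps)
qed

lemma B_bounds: "0 \<le> B" "2 * B \<le> k\<^sup>2"
proof -
  show "0 \<le> B"
    unfolding B_def using p_pos by simp
  have "k choose 2 \<le> k\<^sup>2"
    using binomial_le_pow[of 2 k] k_ge_3 by simp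
  then have "real (k choose 2) \<le> k\<^sup>2"
    by (rule of_nat_mono)
  moreover have "p ^ (k - 2) \<le> 1"
    using p_pos p_less_1 by (intro power_le_one) auto
  ultimately have "real (k choose 2) * p ^ (k - 2) \<le> real (k\<^sup>2) * 1"
    using p_pos by (intro mult_mono) auto
  then show "2 * B \<le> k\<^sup>2"
    by (simp add: B_def)
qed

lemma n_ge_1: "1 \<le> real n"
  using n_pos by simp

lemma ev_r_sq_le: "ev (\<lambda>S. (r S)\<^sup>2) \<le> C1 * n\<^sup>2"
proof -
  have B1: "(B * (1 - 2 * p))\<^sup>2 \<le> k ^ 4"
  proof -
    have "\<bar>B * (1 - 2 * p)\<bar> \<le> real (k\<^sup>2) * 1"
      unfolding abs_mult using B_bounds p_pos p_less_1 by (intro mult_mono) auto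
    then have "\<bar>B * (1 - 2 * p)\<bar>\<^sup>2 \<le> (k\<^sup>2)\<^sup>2"
      using power_mono[of "\<bar>B * (1 - 2 * p)\<bar>" "k\<^sup>2" 2] by simp
    then show ?thesis
      by simp
  qed
  have B2: "(2 * B)\<^sup>2 \<le> k ^ 4"
    using power_mono[of "2 * B" "k\<^sup>2" 2] B_bounds by simp
  have "ev (\<lambda>S. (r S)\<^sup>2) \<le> ev (\<lambda>S. 3 * (k ^ 4 * (M S)\<^sup>2 + k ^ 4 * (e2 S)\<^sup>2 + (Y S)\<^sup>2))"
  proof (rule ev_mono)
    fix S
    have "(r S)\<^sup>2 \<le> 3 * ((B * (1 - 2 * p) * M S)\<^sup>2 + (2 * B * e2 S)\<^sup>2 + (Y S)\<^sup>2)"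
      unfolding r_eq_chaos by (rule sum3_sq_le)
    also have "\<dots> \<le> 3 * (k ^ 4 * (M S)\<^sup>2 + k ^ 4 * (e2 S)\<^sup>2 + (Y S)\<^sup>2)"
      unfolding power_mult_distrib[of _ "M S"] power_mult_distrib[of _ "e2 S"]
      by (intro mult_left_mono add_mono mult_right_mono B1 B2) auto
    finally show "(r S)\<^sup>2 \<le> 3 * (k ^ 4 * (M S)\<^sup>2 + k ^ 4 * (e2 S)\<^sup>2 + (Y S)\<^sup>2)" .
  qed
  also have "\<dots> = 3 * (k ^ 4 * (n * v) + k ^ 4 * ev (\<lambda>S. (e2 S)\<^sup>2) + ev (\<lambda>S. (Y S)\<^sup>2))"
    by (simp only: ev_mult_left ev_add ev_M_sq)
  also have "\<dots> \<le> 3 * (k ^ 4 * real (n\<^sup>2) + k ^ 4 * real (n\<^sup>2) + real (L\<^sup>2 * n\<^sup>2))"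
  proof (intro mult_left_mono add_mono)
    have "real n * v \<le> real n * real n"
      using v_le_1 n_ge_1 by (intro mult_left_mono) linarith+
    then show "real n * v \<le> real (n\<^sup>2)"
      by (simp add: power2_eq_square)
    show "ev (\<lambda>S. (e2 S)\<^sup>2) \<le> real (n\<^sup>2)"
      using ev_e2_sq_le by simp
    show "ev (\<lambda>S. (Y S)\<^sup>2) \<le> real (L\<^sup>2 * n\<^sup>2)"
      using ev_Y_sq_le by simp
  qed auto
  also have "\<dots> = C1 * n\<^sup>2"
    by (simp add: C1_def algebra_simps)
  finally show ?thesis .
qed

lemma kAP_mean_eq: "kAP_mean k p n = \<mu>"
  unfolding kAP_mean_def expectation_eq_ev kAP_expansion[abs_def]
  by (simp add: ev_add ev_mult_left ev_M ev_e2 ev_Y)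

abbreviation \<sigma> :: real where
  "\<sigma> \<equiv> kAP_sd k p n"

lemma sd_sq: "\<sigma>\<^sup>2 = ev (\<lambda>S. (X S - \<mu>)\<^sup>2)"
proof -
  have "\<sigma> = sqrt (ev (\<lambda>S. (X S - \<mu>)\<^sup>2))"
    using kAP_mean_eq unfolding kAP_sd_def kAP_mean_def expectation_eq_ev by simp
  moreover have "0 \<le> ev (\<lambda>S. (X S - \<mu>)\<^sup>2)"
    by (rule ev_nonneg) simp
  ultimately show ?thesis
    by simp
qed

lemma slope_pos: "0 < slope"
  unfolding slope_def using p_pos k_ge_3 by simp

lemma T0_ge_1: "1 \<le> T0"
  by (simp add: T0_def)

lemma c0_pos: "0 < c0"
  by (simp add: c0_def)

lemma c0_le: "c0 \<le> 1"
proof -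
  have "exp (- (k\<^sup>2 * L\<^sup>2 * T0\<^sup>2)) \<le> 1"
    by simp
  then show ?thesis
    unfolding c0_def by linarith
qed

lemma const_nonneg: "0 \<le> C1" "0 \<le> C\<^sub>\<kappa>" "0 \<le> C3" "0 \<le> C4" "0 < C5" "0 \<le> C7"
  and K_ge_1: "1 \<le> K"
proof -
  show C1: "0 \<le> C1"
    unfolding C1_def by simp
  then show "0 \<le> C4"
    unfolding C4_def by simp
  show Ck: "0 \<le> C\<^sub>\<kappa>"
    unfolding C\<^sub>\<kappa>_def using slope_pos by simp
  with C1 show "0 \<le> C3"
    unfolding C3_def by simp
  show C5: "0 < C5"
    unfolding C5_def using slope_pos v_pos by simp
  have "sqrt c0 \<le> 1"
    using c0_le by simp
  then have "sqrt c0 \<le> 2"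
    by linarith
  then show K: "1 \<le> K"
    unfolding K_def using c0_pos by (intro iffD2[OF le_divide_eq_1_pos]) auto
  show "0 \<le> C7"
    unfolding C7_def using K Ck C5 \<open>0 \<le> C4\<close> by simp
qed

lemma deviation_pos: "0 < deviation"
  unfolding deviation_def using c0_pos K_ge_1 by simp

context
  assumes large: "threshold \<le> real n"
begin

lemma thresholds:
  "12 * k / p ^ (k - 1) \<le> real n" "4 * C1 / (slope\<^sup>2 * v) \<le> real n" "2 * pi / slope \<le> real n"
  "1 / C5 \<le> real n" "(2 * (exp (k\<^sup>2 * L\<^sup>2 * T0\<^sup>2) * (C * T0 ^ 3)))\<^sup>2 \<le> real n"
  "(8 * (C3 + C7) / c0)\<^sup>2 \<le> real n"
proof -
  have nonneg: "0 \<le> 12 * k / p ^ (k - 1)" "0 \<le> 4 * C1 / (slope\<^sup>2 * v)" "0 \<le> 2 * pi / slope" "0 \<le> 1 / C5"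
    "0 \<le> (2 * (exp (k\<^sup>2 * L\<^sup>2 * T0\<^sup>2) * (C * T0 ^ 3)))\<^sup>2" "0 \<le> (8 * (C3 + C7) / c0)\<^sup>2"
    using p_pos const_nonneg slope_pos v_pos by (simp_all add: less_imp_le)
  show "12 * k / p ^ (k - 1) \<le> real n" "4 * C1 / (slope\<^sup>2 * v) \<le> real n" "2 * pi / slope \<le> real n"
    "1 / C5 \<le> real n" "(2 * (exp (k\<^sup>2 * L\<^sup>2 * T0\<^sup>2) * (C * T0 ^ 3)))\<^sup>2 \<le> real n"
    "(8 * (C3 + C7) / c0)\<^sup>2 \<le> real n"
    using large nonneg unfolding threshold_def by linarith+
qed

text \<open>\<open>A0\<close> is at least \<open>k * p ^ (k - 1) * n / 3\<close>, and
  \<open>12 * k \<le> p ^ (k - 1) * n\<close> keeps the correction \<open>k\<^sup>2 / 2\<close>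
  below a 24th of \<open>k * p ^ (k - 1) * n\<close>; this leaves more than the quarter in
  \<open>slope\<close>.\<close>

lemma A_bounds: "slope * n \<le> A" "A \<le> k * n"
proof -
  have pk: "0 < p ^ (k - 1)" "p ^ (k - 1) \<le> 1"
    using p_pos p_less_1 by (auto intro!: power_le_one)
  have n12: "12 * k \<le> p ^ (k - 1) * n"
    using thresholds(1) pk by (simp add: divide_le_eq mult.commute)
  also have "\<dots> \<le> 1 * real n"
    using pk by (intro mult_right_mono) auto
  finally have kn: "12 * real k \<le> n"
    by simp
  have k3: "3 \<le> real k"
    using k_ge_3 by simp
  have "n \<le> 2 * (n div 2) + 1" "2 * (n div 2) \<le> n"
    by presburger+
  then have half: "real n \<le> 2 * real (n div 2) + 1" "2 * real (n div 2) \<le> real n"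
    by linarith+
  define b where "b = B * (1 - 2 * p)"
  have Bk: "\<bar>b\<bar> \<le> (real k)\<^sup>2 / 2"
    unfolding b_def
  proof -
    have "\<bar>B * (1 - 2 * p)\<bar> \<le> B * 1"
      unfolding abs_mult using B_bounds p_pos p_less_1 by (intro mult_mono) auto
    then show "\<bar>B * (1 - 2 * p)\<bar> \<le> (real k)\<^sup>2 / 2"
      using B_bounds(2) by simp
  qed
  have "k * p ^ (k - 1) * (n / 3) \<le> A0"
    unfolding A0_def using half kn k3 pk by (simp add: mult.commute mult.left_commute)
  moreover have "real k * (12 * real k) \<le> real k * (p ^ (k - 1) * n)"
    using n12 by (intro mult_left_mono) auto
  ultimately show "slope * n \<le> A"
    unfolding A_def slope_def b_def[symmetric] using Bk by (simp add: power2_eq_square algebra_simps)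
  have "real (n div 2) \<le> n / 2"
    using half by linarith
  then have "A0 \<le> real k * (n / 2) * 1"
    unfolding A0_def of_nat_mult using pk by (intro mult_mono mult_left_mono) auto
  moreover have "real k * real k \<le> real k * real n"
    using kn k3 by (intro mult_left_mono) auto
  ultimately show "A \<le> k * n"
    unfolding A_def b_def[symmetric] using Bk by (simp add: power2_eq_square algebra_simps)
qed

lemma A_pos: "0 < A"
  using A_bounds(1) slope_pos n_pos by (smt (verit) mult_pos_pos of_nat_0_less_iff)

section \<open>The test function and its expectation\<close>

definition \<tau> :: real where
  "\<tau> = 2 * pi / A"

text \<open>The phase must be a function of kAP alone, so \<open>B * (M S)\<^sup>2\<close> is
  cancelled through \<open>(X S - \<mu>)\<^sup>2\<close>, whose main part is
  \<open>A\<^sup>2 * (M S)\<^sup>2\<close>.\<close>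

definition \<kappa> :: real where
  "\<kappa> = \<tau> * B / A\<^sup>2"

lemma \<tau>_bounds: "0 < \<tau>" "\<tau> \<le> 1" "\<tau> * n \<le> T0" "2 / \<tau> \<le> k * n" "\<tau> \<le> 2 * pi / slope / n"
proof -
  have sn: "0 < slope * n"
    using slope_pos n_pos by simp
  show "0 < \<tau>"
    unfolding \<tau>_def using A_pos by simp
  have "\<tau> \<le> 2 * pi / (slope * n)"
    unfolding \<tau>_def using A_bounds sn by (intro frac_le) auto
  then show le: "\<tau> \<le> 2 * pi / slope / n"
    by simp
  have "2 * pi / slope / n \<le> n / real n"
    by (rule divide_right_mono[OF thresholds(3)]) simp
  then have "2 * pi / slope / n \<le> 1"
    using n_pos by simp
  then show "\<tau> \<le> 1"
    using le by linarith
  have "\<tau> * n \<le> 2 * pi / slope / n * n"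
    using le by (rule mult_right_mono) simp
  then have "\<tau> * n \<le> 2 * pi / slope"
    using n_pos by simp
  then show "\<tau> * n \<le> T0"
    by (simp add: T0_def)
  have "2 / \<tau> = A / pi"
    unfolding \<tau>_def by simp
  also have "\<dots> \<le> A / 1"
    using A_pos pi_ge_two by (intro divide_left_mono) auto
  finally show "2 / \<tau> \<le> k * n"
    using A_bounds by simp
qed

lemma \<kappa>_bounds: "0 \<le> \<kappa>" "\<kappa> \<le> C\<^sub>\<kappa> / n ^ 3"
proof -
  show "0 \<le> \<kappa>"
    unfolding \<kappa>_def using \<tau>_bounds B_bounds by simp
  have "(slope * n)\<^sup>2 \<le> A\<^sup>2"
    using A_bounds slope_pos by (intro power_mono) auto
  moreover have "\<tau> * B \<le> (2 * pi / slope / n) * k\<^sup>2"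
    using \<tau>_bounds B_bounds by (intro mult_mono) auto
  ultimately have "\<kappa> \<le> (2 * pi / slope / n) * k\<^sup>2 / (slope * n)\<^sup>2"
    unfolding \<kappa>_def using slope_pos n_pos B_bounds \<tau>_bounds by (intro frac_le) auto
  also have "\<dots> = C\<^sub>\<kappa> / n ^ 3"
    by (simp add: C\<^sub>\<kappa>_def power_mult_distrib power2_eq_square power3_eq_cube)
  finally show "\<kappa> \<le> C\<^sub>\<kappa> / n ^ 3" .
qed

text \<open>In \<open>X S - \<mu> = A * M S + r S\<close> the first term has second moment of order
  \<open>n ^ 3\<close>, the second at most of order \<open>n\<^sup>2\<close>.\<close>

lemma sd_sq_bounds: "C5 * n ^ 3 \<le> \<sigma>\<^sup>2" "\<sigma>\<^sup>2 \<le> C4 * n ^ 3"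
proof -
  have X: "X S - \<mu> = A * M S + r S" for S
    by (simp add: r_def)
  have n23: "real n ^ 2 \<le> real n ^ 3"
    using n_ge_1 by (intro power_increasing) auto
  have "\<sigma>\<^sup>2 \<le> ev (\<lambda>S. 2 * A\<^sup>2 * (M S)\<^sup>2 + 2 * (r S)\<^sup>2)"
    unfolding sd_sq X
  proof (rule ev_mono)
    fix S
    show "(A * M S + r S)\<^sup>2 \<le> 2 * A\<^sup>2 * (M S)\<^sup>2 + 2 * (r S)\<^sup>2"
      using sum2_sq_le[of "A * M S" "r S"] by (simp add: power_mult_distrib)
  qed
  also have "\<dots> = 2 * A\<^sup>2 * (n * v) + 2 * ev (\<lambda>S. (r S)\<^sup>2)"
    by (simp only: ev_add ev_mult_left ev_M_sq)
  also have "\<dots> \<le> 2 * (real k * real n)\<^sup>2 * (real n * 1) + 2 * (C1 * real n ^ 3)"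
  proof (intro add_mono mult_mono mult_left_mono)
    show "A\<^sup>2 \<le> (real k * real n)\<^sup>2"
      using power_mono[OF A_bounds(2), of 2] A_pos by simp
    show "ev (\<lambda>S. (r S)\<^sup>2) \<le> C1 * real n ^ 3"
      using ev_r_sq_le mult_left_mono[OF n23 const_nonneg(1)] by simp
  qed (use v_le_1 v_pos in \<open>auto intro!: ev_nonneg\<close>)
  also have "\<dots> = C4 * n ^ 3"
    by (simp add: C4_def power2_eq_square power3_eq_cube algebra_simps)
  finally show "\<sigma>\<^sup>2 \<le> C4 * n ^ 3" .
  have "ev (\<lambda>S. A\<^sup>2 * (M S)\<^sup>2) \<le> ev (\<lambda>S. 2 * (X S - \<mu>)\<^sup>2 + 2 * (r S)\<^sup>2)"
  proof (rule ev_mono)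
    fix S
    have "A * M S = (X S - \<mu>) + (- r S)"
      by (simp add: r_def)
    then have "(A * M S)\<^sup>2 \<le> 2 * (X S - \<mu>)\<^sup>2 + 2 * (- r S)\<^sup>2"
      by (simp only: sum2_sq_le)
    then show "A\<^sup>2 * (M S)\<^sup>2 \<le> 2 * (X S - \<mu>)\<^sup>2 + 2 * (r S)\<^sup>2"
      by (simp only: power_mult_distrib power2_minus)
  qed
  then have "A\<^sup>2 * (n * v) \<le> 2 * \<sigma>\<^sup>2 + 2 * ev (\<lambda>S. (r S)\<^sup>2)"
    by (simp only: ev_add ev_mult_left ev_M_sq sd_sq)
  then have "A\<^sup>2 * (n * v) \<le> 2 * \<sigma>\<^sup>2 + 2 * (C1 * n\<^sup>2)"
    using ev_r_sq_le by linarith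
  moreover have "(slope * n)\<^sup>2 * (n * v) \<le> A\<^sup>2 * (n * v)"
    using A_bounds slope_pos v_pos by (intro mult_right_mono power_mono) auto
  moreover have "4 * C1 * n\<^sup>2 \<le> (slope\<^sup>2 * v * n) * n\<^sup>2"
    using thresholds(2) slope_pos v_pos by (intro mult_right_mono) (simp_all add: divide_le_eq mult.commute)
  ultimately show "C5 * n ^ 3 \<le> \<sigma>\<^sup>2"
    by (simp add: C5_def power_mult_distrib power2_eq_square power3_eq_cube algebra_simps)
qed

lemma sd_bounds: "1 \<le> \<sigma>" "sqrt C5 * (n * sqrt n) \<le> \<sigma>" "\<sigma> \<le> sqrt C4 * (n * sqrt n)"
proof -
  have nn: "0 \<le> \<sigma>"
    unfolding kAP_sd_def by (simp add: measure_pmf.variance_positive)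
  have sq: "sqrt (x * real n ^ 3) = sqrt x * (n * sqrt n)" for x
    by (simp add: real_sqrt_mult power3_eq_cube)
  show "sqrt C5 * (n * sqrt n) \<le> \<sigma>"
    using real_sqrt_le_mono[OF sd_sq_bounds(1)] nn by (simp add: sq)
  show "\<sigma> \<le> sqrt C4 * (n * sqrt n)"
    using real_sqrt_le_mono[OF sd_sq_bounds(2)] nn by (simp add: sq)
  have "1 \<le> C5 * n"
    using thresholds(4) const_nonneg(5) by (simp add: divide_le_eq mult.commute)
  also have "\<dots> \<le> C5 * n ^ 3"
    using const_nonneg(5) n_ge_1 power_increasing[of 1 3 "real n"] by (intro mult_left_mono) auto
  also have "\<dots> \<le> \<sigma>\<^sup>2"
    by (rule sd_sq_bounds)
  finally show "1 \<le> \<sigma>"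
    using nn by (metis one_power2 power2_le_imp_le)
qed

lemma ev_M_r_le: "ev (\<lambda>S. \<bar>M S * r S\<bar>) \<le> (1 + C1) / 2 * (n * sqrt n)"
proof -
  let ?s = "sqrt n"
  have s: "0 < ?s" "?s * ?s = n"
    using n_pos by auto
  have "ev (\<lambda>S. \<bar>M S * r S\<bar>) \<le> ev (\<lambda>S. 1 / 2 * (?s * (M S)\<^sup>2 + 1 / ?s * (r S)\<^sup>2))"
  proof (rule ev_mono)
    fix S
    have "?s * (2 * \<bar>M S * r S\<bar>) = 2 * (?s * \<bar>M S\<bar>) * \<bar>r S\<bar>"
      by (simp add: abs_mult)
    also have "\<dots> \<le> (?s * \<bar>M S\<bar>)\<^sup>2 + \<bar>r S\<bar>\<^sup>2"
      by (rule sum_squares_bound)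
    also have "\<dots> = ?s * (?s * (M S)\<^sup>2 + 1 / ?s * (r S)\<^sup>2)"
      using s(1) by (simp add: power2_eq_square algebra_simps)
    finally have "2 * \<bar>M S * r S\<bar> \<le> ?s * (M S)\<^sup>2 + 1 / ?s * (r S)\<^sup>2"
      using s(1) by (rule mult_left_le_imp_le)
    then show "\<bar>M S * r S\<bar> \<le> 1 / 2 * (?s * (M S)\<^sup>2 + 1 / ?s * (r S)\<^sup>2)"
      by simp
  qed
  also have "\<dots> = 1 / 2 * (?s * (n * v) + 1 / ?s * ev (\<lambda>S. (r S)\<^sup>2))"
    by (simp only: ev_mult_left ev_add ev_M_sq)
  also have "\<dots> \<le> 1 / 2 * (?s * (n * 1) + 1 / ?s * (C1 * n\<^sup>2))"
    using s v_le_1 ev_r_sq_le by (intro mult_left_mono add_mono) auto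
  also have "1 / ?s * (C1 * n\<^sup>2) = C1 * (n * ?s)"
  proof -
    have "(real n)\<^sup>2 = ?s * (n * ?s)"
      using s(2) by (simp add: power2_eq_square mult.commute mult.left_commute)
    then have "1 / ?s * (C1 * (real n)\<^sup>2) = C1 * (n * ?s)"
      using s(1) by (simp only:) simp
    then show ?thesis
      by simp
  qed
  finally show ?thesis
    by (simp add: algebra_simps)
qed

definition F :: "real \<Rightarrow> complex" where
  "F u = cis (\<tau> * u - \<kappa> * u\<^sup>2)"

text \<open>The frequency \<open>\<tau> = 2\<pi> / A\<close> turns the linear term \<open>A * M\<close> into a constant phase, because \<open>M\<close>
  differs from an integer by a constant; the quadratic term \<open>\<kappa>\<close> cancels \<open>B * M\<^sup>2\<close>.\<close>

lemma norm_ev_F_ge: "cmod (chf (\<tau> * n)) - C3 / sqrt n \<le> cmod (ev (\<lambda>S. F (X S - \<mu>)))"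
proof -
  define w where "w = cis (- 2 * pi * p * n - \<tau> * B * n * v)"
  have pointwise: "cmod (w * cis (\<tau> * Y S) - F (X S - \<mu>)) \<le> \<kappa> * (2 * A * \<bar>M S * r S\<bar> + (r S)\<^sup>2)"
    if S: "S \<subseteq> {..<n}" for S
  proof -
    \<comment> \<open>What remains of the quadratic phase besides
      \<open>\<kappa> * A\<^sup>2 * (M S)\<^sup>2\<close>.\<close>
    define \<rho> where "\<rho> = \<kappa> * (2 * A * (M S * r S) + (r S)\<^sup>2)"
    have \<tau>A: "\<tau> * A = 2 * pi" and \<kappa>A: "\<kappa> * A\<^sup>2 = \<tau> * B"
      using A_pos by (auto simp: \<tau>_def \<kappa>_def)
    have u: "X S - \<mu> = A * M S + r S"
      by (simp add: r_def)
    have "\<tau> * (X S - \<mu>) - \<kappa> * (X S - \<mu>)\<^sup>2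
        = (\<tau> * A) * M S + \<tau> * r S - (\<kappa> * A\<^sup>2) * (M S)\<^sup>2 - \<rho>"
      unfolding u \<rho>_def by (simp add: power2_eq_square algebra_simps)
    also have "\<dots> = 2 * pi * M S - \<tau> * B * n * v + \<tau> * Y S - \<rho>"
      unfolding \<tau>A \<kappa>A r_eq_quadratic by (simp add: algebra_simps)
    also have "\<dots> = 2 * pi * card S + ((- 2 * pi * p * n - \<tau> * B * n * v) + (\<tau> * Y S - \<rho>))"
      unfolding M_eq_card[OF S] by (simp add: algebra_simps)
    finally have "F (X S - \<mu>) = cis (2 * pi * card S) * (w * cis (\<tau> * Y S - \<rho>))"
      unfolding F_def w_def by (simp only: cis_mult)
    also have "cis (2 * pi * card S) = 1"
      by (rule cis_multiple_2pi) simp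
    finally have "w * cis (\<tau> * Y S) - F (X S - \<mu>) = w * (cis (\<tau> * Y S) - cis (\<tau> * Y S - \<rho>))"
      by (simp add: algebra_simps)
    also have "cmod \<dots> \<le> \<bar>\<rho>\<bar>"
      using norm_cis_diff_le[of "\<tau> * Y S" "\<tau> * Y S - \<rho>"] by (simp add: norm_mult w_def)
    also have "\<dots> \<le> \<kappa> * (2 * A * \<bar>M S * r S\<bar> + (r S)\<^sup>2)"
      unfolding \<rho>_def abs_mult[of \<kappa>] using \<kappa>_bounds(1) A_pos
      by (intro mult_mono order_trans[OF abs_triangle_ineq]) (auto simp: abs_mult)
    finally show ?thesis .
  qed
  have "cmod (w * chf (\<tau> * n) - ev (\<lambda>S. F (X S - \<mu>)))
      = cmod (ev (\<lambda>S. w * cis (\<tau> * Y S) - F (X S - \<mu>)))"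
    using n_pos by (simp add: ev_diff ev_mult_left chf_def)
  also have "\<dots> \<le> ev (\<lambda>S. \<kappa> * (2 * A * \<bar>M S * r S\<bar> + (r S)\<^sup>2))"
    by (rule norm_ev_bound) (rule pointwise)
  also have "\<dots> = \<kappa> * (2 * A * ev (\<lambda>S. \<bar>M S * r S\<bar>) + ev (\<lambda>S. (r S)\<^sup>2))"
    by (simp only: ev_mult_left ev_add)
  \<comment> \<open>With \<open>\<kappa>\<close> of order \<open>n\<close> to the power -3 and the
    bracket of order \<open>n\<^sup>2 * sqrt n\<close>, the error is of order
    \<open>1 / sqrt n\<close>.\<close>
  also have "\<dots> \<le> C\<^sub>\<kappa> / n ^ 3 * (2 * (k * n) * ((1 + C1) / 2 * (n * sqrt n)) + C1 * n\<^sup>2)"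
    using \<kappa>_bounds A_bounds A_pos ev_M_r_le ev_r_sq_le const_nonneg
    by (intro mult_mono add_mono) (auto intro!: ev_nonneg add_nonneg_nonneg mult_nonneg_nonneg)
  also have "\<dots> \<le> C\<^sub>\<kappa> / n ^ 3 * (2 * (k * n) * ((1 + C1) / 2 * (n * sqrt n)) + C1 * (n\<^sup>2 * sqrt n))"
    using const_nonneg n_ge_1 by (intro mult_left_mono add_left_mono) auto
  also have "\<dots> = C3 * (sqrt n / n)"
  proof -
    have "2 * (k * n) * ((1 + C1) / 2 * (n * sqrt n)) + C1 * (n\<^sup>2 * sqrt n)
        = (k * (1 + C1) + C1) * ((real n)\<^sup>2 * sqrt n)"
      by (simp add: power2_eq_square algebra_simps)
    moreover have "C\<^sub>\<kappa> / n ^ 3 * (x * ((real n)\<^sup>2 * sqrt n)) = C\<^sub>\<kappa> * x * (sqrt n / n)" for x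
      using n_pos by (simp add: power2_eq_square power3_eq_cube)
    ultimately show ?thesis
      unfolding C3_def by (simp only:)
  qed
  also have "sqrt n / n = 1 / sqrt n"
    using n_pos by (simp add: real_div_sqrt field_simps)
  finally have "cmod (w * chf (\<tau> * n) - ev (\<lambda>S. F (X S - \<mu>))) \<le> C3 / sqrt n"
    by simp
  moreover have "cmod (w * chf (\<tau> * n)) = cmod (chf (\<tau> * n))"
    by (simp add: norm_mult w_def)
  ultimately show ?thesis
    using norm_triangle_ineq2[of "w * chf (\<tau> * n)" "ev (\<lambda>S. F (X S - \<mu>))"] by linarith
qed

text \<open>The factor \<open>2 / \<tau>\<close> is of order \<open>n\<close>, while
  \<open>1 / \<sigma>\<close> and \<open>\<kappa> * \<sigma>\<close> are of order
  \<open>1 / (n * sqrt n)\<close>.\<close>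

lemma window_sum_le:
  "cmod (\<Sum>x | \<bar>real_of_int x - \<mu>\<bar> \<le> K * \<sigma>. gauss \<sigma> (x - \<mu>) *\<^sub>R F (x - \<mu>)) \<le> C7 / sqrt n"
proof -
  define N where "N = real n * sqrt n"
  have N: "0 < N" "1 \<le> N" "N * N = n ^ 3"
    using n_ge_1 mult_mono[of 1 "real n" 1 "sqrt n"]
    by (auto simp: N_def power3_eq_cube mult.commute mult.left_commute)
  have s: "0 < \<sigma>"
    using sd_bounds(1) by simp
  have "cmod (\<Sum>x | \<bar>real_of_int x - \<mu>\<bar> \<le> K * \<sigma>. gauss \<sigma> (x - \<mu>) *\<^sub>R F (x - \<mu>))
      \<le> 2 / \<tau> * (2 / \<sigma> + 2 * K * \<sigma> * (1 / \<sigma>\<^sup>2 + \<kappa> * (2 * K * \<sigma> + 1) / \<sigma>))"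
    unfolding F_def using s K_ge_1 \<tau>_bounds \<kappa>_bounds
    by (intro gauss_exponential_sum_le) auto
  also have "2 / \<sigma> + 2 * K * \<sigma> * (1 / \<sigma>\<^sup>2 + \<kappa> * (2 * K * \<sigma> + 1) / \<sigma>)
      = (2 + 2 * K) / \<sigma> + 2 * K * (\<kappa> * (2 * K * \<sigma> + 1))"
    using s by (simp add: field_simps power2_eq_square)
  also have "2 / \<tau> * \<dots> \<le> (k * n) * ((2 + 2 * K) / (sqrt C5 * N)
      + 2 * K * (C\<^sub>\<kappa> / (N * N) * ((2 * K * sqrt C4 + 1) * N)))"
  proof (intro mult_mono add_mono mult_left_mono)
    show "(2 + 2 * K) / \<sigma> \<le> (2 + 2 * K) / (sqrt C5 * N)"
      using sd_bounds(2) K_ge_1 const_nonneg(5) N s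
      by (intro divide_left_mono) (auto simp: N_def[symmetric])
    show "\<kappa> \<le> C\<^sub>\<kappa> / (N * N)"
      using \<kappa>_bounds(2) N(3) by simp
    have "2 * K * \<sigma> \<le> 2 * K * (sqrt C4 * N)"
      using sd_bounds(3) K_ge_1 by (intro mult_left_mono) (auto simp: N_def)
    then show "2 * K * \<sigma> + 1 \<le> (2 * K * sqrt C4 + 1) * N"
      using N(2) by (simp add: algebra_simps)
  qed (use \<tau>_bounds \<kappa>_bounds K_ge_1 const_nonneg s N in
      \<open>auto intro!: add_nonneg_nonneg mult_nonneg_nonneg divide_nonneg_nonneg\<close>)
  also have "\<dots> = C7 * (n / N)"
  proof -
    have cancel: "C\<^sub>\<kappa> / (N * N) * (x * N) = C\<^sub>\<kappa> * x / N" for x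
      using N(1) by simp
    show ?thesis
      unfolding cancel C7_def by (simp add: algebra_simps add_divide_distrib)
  qed
  also have "n / N = 1 / sqrt n"
    using n_pos by (simp add: N_def)
  finally show ?thesis
    by simp
qed

text \<open>Three contributions: the oscillating Gaussian sum over the window, at most
  \<open>3 * K * \<sigma>\<close> pointwise errors of size \<open>deviation / \<sigma>\<close>, and
  the Chebyshev tail outside the window.\<close>

lemma norm_ev_F_le:
  assumes close: "\<And>x::int. \<bar>ev (\<lambda>S. of_bool (int (kAP k n S) = x)) - gauss \<sigma> (x - \<mu>)\<bar> \<le> deviation / \<sigma>"
  shows "cmod (ev (\<lambda>S. F (X S - \<mu>))) \<le> C7 / sqrt n + 3 * K * deviation + 1 / K\<^sup>2"
proof -
  let ?W = "{x::int. \<bar>x - \<mu>\<bar> \<le> K * \<sigma>}"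
  let ?q = "\<lambda>x::int. ev (\<lambda>S. of_bool (int (kAP k n S) = x)) :: real"
  have s: "0 < \<sigma>" and Ks: "1 \<le> K * \<sigma>"
    using sd_bounds(1) K_ge_1 mult_mono[of 1 K 1 \<sigma>] by auto
  have finite_W: "finite ?W"
    unfolding window_eq by simp
  have "ev (\<lambda>S. F (X S - \<mu>)) = ev (\<lambda>S. (\<Sum>x\<in>?W. of_bool (int (kAP k n S) = x) *\<^sub>R F (x - \<mu>))
      + of_bool (K * \<sigma> < \<bar>X S - \<mu>\<bar>) *\<^sub>R F (X S - \<mu>))"
  proof (rule ev_cong)
    fix S
    have "(\<Sum>x\<in>?W. of_bool (int (kAP k n S) = x) *\<^sub>R F (x - \<mu>))
        = (\<Sum>x\<in>?W. if int (kAP k n S) = x then F (x - \<mu>) else 0)"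
      by (rule sum.cong) auto
    also have "\<dots> = (if int (kAP k n S) \<in> ?W then F (X S - \<mu>) else 0)"
      using finite_W by (simp add: sum.delta')
    finally show "F (X S - \<mu>) = (\<Sum>x\<in>?W. of_bool (int (kAP k n S) = x) *\<^sub>R F (x - \<mu>))
      + of_bool (K * \<sigma> < \<bar>X S - \<mu>\<bar>) *\<^sub>R F (X S - \<mu>)"
      by auto
  qed
  also have "\<dots> = (\<Sum>x\<in>?W. ?q x *\<^sub>R F (x - \<mu>)) + ev (\<lambda>S. of_bool (K * \<sigma> < \<bar>X S - \<mu>\<bar>) *\<^sub>R F (X S - \<mu>))"
    unfolding ev_add ev_sum ev_linear[OF bounded_linear_scaleR_left] ..
  also have "(\<Sum>x\<in>?W. ?q x *\<^sub>R F (x - \<mu>))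
      = (\<Sum>x\<in>?W. gauss \<sigma> (x - \<mu>) *\<^sub>R F (x - \<mu>)) + (\<Sum>x\<in>?W. (?q x - gauss \<sigma> (x - \<mu>)) *\<^sub>R F (x - \<mu>))"
    by (simp add: scaleR_diff_left sum_subtractf)
  finally have split: "ev (\<lambda>S. F (X S - \<mu>)) = (\<Sum>x\<in>?W. gauss \<sigma> (x - \<mu>) *\<^sub>R F (x - \<mu>))
      + (\<Sum>x\<in>?W. (?q x - gauss \<sigma> (x - \<mu>)) *\<^sub>R F (x - \<mu>))
      + ev (\<lambda>S. of_bool (K * \<sigma> < \<bar>X S - \<mu>\<bar>) *\<^sub>R F (X S - \<mu>))" .
  have norm_F: "cmod (F u) = 1" for u
    by (simp add: F_def)
  have "cmod (\<Sum>x\<in>?W. (?q x - gauss \<sigma> (x - \<mu>)) *\<^sub>R F (x - \<mu>)) \<le> (\<Sum>x\<in>?W. deviation / \<sigma>)"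
    by (rule sum_norm_le) (use close in \<open>simp add: norm_F\<close>)
  also have "\<dots> = card ?W * (deviation / \<sigma>)"
    by simp
  also have "\<dots> \<le> (3 * (K * \<sigma>)) * (deviation / \<sigma>)"
    using card_window_le[of "K * \<sigma>" \<mu>] Ks s deviation_pos by (intro mult_right_mono) auto
  also have "\<dots> = 3 * K * deviation"
    using s by simp
  finally have middle: "cmod (\<Sum>x\<in>?W. (?q x - gauss \<sigma> (x - \<mu>)) *\<^sub>R F (x - \<mu>)) \<le> 3 * K * deviation" .
  have "cmod (ev (\<lambda>S. of_bool (K * \<sigma> < \<bar>X S - \<mu>\<bar>) *\<^sub>R F (X S - \<mu>)))
      \<le> ev (\<lambda>S. 1 / (K * \<sigma>)\<^sup>2 * (X S - \<mu>)\<^sup>2)"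
  proof (rule norm_ev_bound)
    fix S
    show "cmod (of_bool (K * \<sigma> < \<bar>X S - \<mu>\<bar>) *\<^sub>R F (X S - \<mu>)) \<le> 1 / (K * \<sigma>)\<^sup>2 * (X S - \<mu>)\<^sup>2"
    proof (cases "K * \<sigma> < \<bar>X S - \<mu>\<bar>")
      case True
      then have "(K * \<sigma>)\<^sup>2 \<le> \<bar>X S - \<mu>\<bar>\<^sup>2"
        using Ks by (intro power_mono) auto
      moreover have "0 < (K * \<sigma>)\<^sup>2"
        using Ks by (intro zero_less_power) linarith
      ultimately have "1 \<le> (X S - \<mu>)\<^sup>2 / (K * \<sigma>)\<^sup>2"
        by simp
      then show ?thesis
        using True by (simp add: norm_F)
    qed simp
  qed
  also have "\<dots> = 1 / K\<^sup>2"
    unfolding ev_mult_left sd_sq[symmetric] using s by (simp add: power_mult_distrib)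
  finally have tail: "cmod (ev (\<lambda>S. of_bool (K * \<sigma> < \<bar>X S - \<mu>\<bar>) *\<^sub>R F (X S - \<mu>))) \<le> 1 / K\<^sup>2" .
  show ?thesis
    unfolding split using window_sum_le middle tail
    by (intro norm_triangle_le add_mono) (auto intro!: norm_triangle_le)
qed

text \<open>Otherwise the expectation of \<open>F\<close> is at least \<open>c0\<close> and at most
  \<open>c0 / 4 + c0 / 4\<close>, up to errors of total size at most \<open>c0 / 8\<close>.\<close>

lemma exists_deviation:
  "\<exists>x::int. deviation / \<sigma> \<le> \<bar>ev (\<lambda>S. of_bool (int (kAP k n S) = x)) - gauss \<sigma> (x - \<mu>)\<bar>"
proof (rule ccontr)
  assume "\<not> ?thesis"
  then have "\<bar>ev (\<lambda>S. of_bool (int (kAP k n S) = x)) - gauss \<sigma> (x - \<mu>)\<bar> \<le> deviation / \<sigma>" for x :: int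
    by (simp add: not_le less_imp_le)
  then have upper: "cmod (ev (\<lambda>S. F (X S - \<mu>))) \<le> C7 / sqrt n + 3 * K * deviation + 1 / K\<^sup>2"
    by (rule norm_ev_F_le)
  have "c0 \<le> cmod (chf (\<tau> * n))"
    unfolding c0_def
  proof (rule chf_lower_bound)
    show "2 * (exp (k\<^sup>2 * L\<^sup>2 * T0\<^sup>2) * (C * T0 ^ 3)) \<le> sqrt n"
      using thresholds(5) by (rule real_le_rsqrt)
  qed (use T0_ge_1 \<tau>_bounds n_pos in auto)
  moreover have "(C3 + C7) / sqrt n \<le> c0 / 8"
  proof -
    have "8 * (C3 + C7) / c0 \<le> sqrt n"
      using thresholds(6) by (rule real_le_rsqrt)
    then show ?thesis
      using c0_pos n_pos by (simp add: field_simps)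
  qed
  moreover have "3 * K * deviation = c0 / 4"
    using K_ge_1 by (simp add: deviation_def)
  moreover have "1 / K\<^sup>2 = c0 / 4"
    using c0_pos by (simp add: K_def power_divide)
  ultimately show False
    using upper norm_ev_F_ge c0_pos unfolding add_divide_distrib by linarith
qed

end

end

theorem theorem1p1:
  fixes p :: real and k :: nat
  assumes "0 < p" and "p < 1" and "k \<ge> 3"
  shows "\<exists>c::real. \<exists>N::nat. c > 0 \<and>
    (\<forall>n::nat. n \<ge> N \<and> gcd n (fact (k - 1)) = 1 \<longrightarrow>
      (\<exists>x::int.
        \<bar>measure_pmf.prob (random_subset_pmf n p) {S. int (kAP k n S) = x}
          - 1 / (kAP_sd k p n * sqrt (2 * pi))
            * exp (- (real_of_int x - kAP_mean k p n)\<^sup>2 / (2 * (kAP_sd k p n)\<^sup>2))\<bar>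
        \<ge> c / kAP_sd k p n))"
proof -
  have ap: "cyclic_ap n p k" if "0 < n" "gcd n (fact (k - 1)) = 1" for n
    using assms that by unfold_locales (auto simp: coprime_iff_gcd_eq_1)
  \<comment> \<open>\<open>deviation\<close> does not depend on \<open>n\<close>, so its positivity
    can be read off at the admissible value 1.\<close>
  have "cyclic_ap 1 p k"
    by (rule ap) auto
  then have pos: "0 < cyclic_ap.deviation p k"
    by (rule cyclic_ap.deviation_pos)
  obtain N :: nat where N: "cyclic_ap.threshold p k \<le> real N"
    using real_arch_simple by blast
  have "\<exists>x::int. \<bar>measure_pmf.prob (random_subset_pmf n p) {S. int (kAP k n S) = x}
          - 1 / (kAP_sd k p n * sqrt (2 * pi))
            * exp (- (real_of_int x - kAP_mean k p n)\<^sup>2 / (2 * (kAP_sd k p n)\<^sup>2))\<bar>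
        \<ge> cyclic_ap.deviation p k / kAP_sd k p n"
    \<comment> \<open>The maximum with 1 ensures the positivity of \<open>n\<close> that
      \<open>cyclic_ap\<close> requires.\<close>
    if n: "max N 1 \<le> n" "gcd n (fact (k - 1)) = 1" for n
  proof -
    interpret cyclic_ap n p k
      by (rule ap) (use n in auto)
    have "threshold \<le> real n"
      using N n by simp
    from exists_deviation[OF this] show ?thesis
      unfolding gauss_def kAP_mean_eq prob_eq_ev .
  qed
  then show ?thesis
    using pos by (intro exI[of _ "cyclic_ap.deviation p k"] exI[of _ "max N 1"]) simp
qed

end
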